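(* Let $I_1$ and $I_2$ be two (either open or closed) non-trivial intervals of $\mathbb R$. Let $G\in C(I_1\times I_2)$ be a continuous function, with values in a metric space $E$, such that $$|G(x_1,x_2)-G(y_1,y_2)|\le\sum_{j=1}^{J_1}|A_{1j}(x_1,y_1;x_2)|+\sum_{j=1}^{J_2}|A_{2j}(y_1;x_2,y_2)|$$ for all $(x_1,x_2),(y_1,y_2)\in I_1\times I_2$, where $A_{1j}:I_1\times I_1\times I_2\to\mathbb R$, $1\le j\le J_1$, and $A_{2j}:I_1\times I_2\times I_2\to\mathbb R$, $1\le j\le J_2$, are measurable functions. Suppose that $$\iiint_{I_1\times I_1\times I_2}\frac{|A_{1j}(u_1,v_1;u_2)|^{q_{1j}}}{|u_1-v_1|^{\beta_{1j}}}\,du_1\,dv_1\,du_2\le M_{1j},\qquad \iiint_{I_1\times I_2\times I_2}\frac{|A_{2j}(v_1;u_2,v_2)|^{q_{2j}}}{|u_2-v_2|^{\beta_{2j}}}\,dv_1\,du_2\,dv_2\le M_{2j}$$ for all $j$, where $q_{ij}\ge1$, $\beta_i:=\min_j\beta_{ij}>2$ for $i=1,2$, and $(\beta_1-2)(\beta_2-2)-1>0$. Fix any $a,b>0$. Then $$|G(x_1,x_2)-G(y_1,y_2)|\le C\sum_jM_{1j}^{1/q_{1j}}\left(|x_1-y_1|^{\gamma^{(1)}_{1j}}+|x_2-y_2|^{\gamma^{(2)}_{1j}}\right)+C\sum_jM_{2j}^{1/q_{2j}}\left(|x_1-y_1|^{\gamma^{(1)}_{2j}}+|x_2-y_2|^{\gamma^{(2)}_{2j}}\right)$$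 for all $(x_1,x_2),(y_1,y_2)\in I_1\times I_2$, where $$\gamma^{(1)}_{1j}=\frac{\beta_{1j}-2-b}{q_{1j}},\quad \gamma^{(2)}_{1j}=\frac{(\beta_{1j}-2)a-1}{q_{1j}},\quad \gamma^{(1)}_{2j}=\frac{(\beta_{2j}-2)b-1}{q_{2j}},\quad \gamma^{(2)}_{2j}=\frac{\beta_{2j}-2-a}{q_{2j}},$$ and $C<\infty$ is a constant that depends on $(q_{ij}),(\beta_{ij}),a,b,|I_1|,|I_2|$.
   Context: For points $x,y$ of the metric space $(E,d)$ we write $|x-y|:=d(x,y)$; for real numbers $|\cdot|$ is the absolute value; and for a Borel set $A\subseteq\mathbb R$ (in particular an interval) $|A|$ denotes its Lebesgue measure.
   Formalization: Adds that |I_1| and |I_2| are both finite or both infinite (the claim fails for I_1=[0,1], I_2=R); C is stated for metric spaces E on one point set, and a constant common to all E follows by applying the case E=R to u -> d(G(x),G(u)). *)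

theory Defs
  imports "HOL-Analysis.Analysis"
begin

definition nontrivial_interval :: "real set \<Rightarrow> bool" where
  "nontrivial_interval I \<longleftrightarrow>
     is_interval I \<and> (open I \<or> closed I) \<and> (\<exists>x\<in>I. \<exists>y\<in>I. x < y)"

end

theory Submission
  imports Defs "HOL-Probability.Probability_Measure"
begin

text \<open>
Fix \<open>x\<close> and let the sides of rectangles \<open>S n \<times> T n\<close> shrink homothetically to \<open>x\<close>, with lengths
comparable to \<open>s * 2 powr - n\<close> and \<open>t * 2 powr - (\<theta> * n)\<close>. Let \<open>D n\<close> be the mean of
\<open>d (G x) (G u)\<close> over \<open>u\<close> in the \<open>n\<close>-th rectangle; \<open>D n\<close> tends to \<open>0\<close> by continuity. The triangle
inequality through an independent point of the next rectangle bounds \<open>D n - D (n + 1)\<close> by the means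
of the \<open>A1 j\<close> and \<open>A2 j\<close>, and Young's inequality bounds these by the given integrals, with
contributions of order \<open>(M1 j * s powr (\<beta>1 j - 2) / t * 2 powr - (n * (\<beta>1 j - 2 - \<theta>))) powr (1 / q1 j)\<close>
and \<open>(M2 j * t powr (\<beta>2 j - 2) / s * 2 powr - (n * (\<theta> * (\<beta>2 j - 2) - 1))) powr (1 / q2 j)\<close>.
The condition on the exponents is what allows a \<open>\<theta>\<close> for which both geometric series converge.
Taking the same initial rectangle for \<open>x\<close> and \<open>y\<close>, with \<open>X = \<bar>x1 - y1\<bar>\<close>, \<open>Y = \<bar>x2 - y2\<bar>\<close>,
\<open>s = max X (Y powr a)\<close> and \<open>t = max Y (X powr b)\<close>, gives the theorem.
\<close>

section \<open>Means over intervals\<close>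

text \<open>Iterated integrals need Borel functions, while the given integrands are only Lebesgue
  measurable. Such an integrand agrees almost everywhere with a Borel function; putting the value
  infinity on a Borel null set that contains both \<open>Z\<close> and the exceptional points makes
  the bound hold at every point without changing the integral.\<close>

lemma borel_majorant:
  fixes f :: "'a::euclidean_space \<Rightarrow> ennreal"
  assumes D: "D \<in> sets borel" and f: "f \<in> borel_measurable (lebesgue_on D)" and Z: "negligible Z"
  obtains K where "K \<in> borel_measurable borel" "\<And>x. x \<in> D \<Longrightarrow> f x \<le> K x" "\<And>x. x \<in> Z \<Longrightarrow> K x = \<infinity>"
    "(\<integral>\<^sup>+x. K x \<partial>lborel) \<le> (\<integral>\<^sup>+x. f x \<partial>lebesgue_on D)"
proof -
  have D': "D \<inter> space lebesgue \<in> sets (lebesgue :: 'a measure)"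
    using D by auto
  have "(\<lambda>x. f x * indicator D x) \<in> borel_measurable lebesgue"
    using f borel_measurable_restrict_space_iff_ennreal[OF D'] by simp
  from completion_ex_borel_measurable[OF this] obtain g
    where g: "g \<in> borel_measurable lborel" "AE x in lborel. f x * indicator D x = g x"
    by auto
  have "AE x in lebesgue. x \<notin> Z"
    using Z by (auto simp: negligible_iff_null_sets intro: AE_not_in)
  then have Z': "AE x in lborel. x \<notin> Z"
    by (simp add: AE_completion_iff)
  with g(2) have "AE x in lborel. f x * indicator D x = g x \<and> x \<notin> Z"
    by eventually_elim auto
  then obtain N where N: "{x \<in> space lborel. \<not> (f x * indicator D x = g x \<and> x \<notin> Z)} \<subseteq> N"
    "emeasure lborel N = 0" "N \<in> sets lborel"
    by (rule AE_E)
  have [measurable]: "N \<in> sets borel" "g \<in> borel_measurable borel"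
    using N g by auto
  define K where "K x = (if x \<in> N then \<infinity> else g x)" for x
  show thesis
  proof
    show "K \<in> borel_measurable borel" unfolding K_def by measurable
    show "f x \<le> K x" if "x \<in> D" for x
    proof (cases "x \<in> N")
      case False
      with N(1) have "f x * indicator D x = g x" by auto
      with that False show ?thesis by (simp add: K_def)
    qed (simp add: K_def)
    show "K x = \<infinity>" if "x \<in> Z" for x
      using that N(1) by (auto simp: K_def)
    have "AE x in lborel. x \<notin> N"
      using N by (intro AE_not_in) auto
    with g(2) have "AE x in lborel. K x = f x * indicator D x"
      by eventually_elim (auto simp: K_def)
    then have "(\<integral>\<^sup>+x. K x \<partial>lborel) = (\<integral>\<^sup>+x. f x * indicator D x \<partial>lborel)"
      by (rule nn_integral_cong_AE)
    also have "\<dots> = (\<integral>\<^sup>+x. f x \<partial>lebesgue_on D)"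
      by (simp add: nn_integral_restrict_space[OF D'] nn_integral_completion)
    finally show "(\<integral>\<^sup>+x. K x \<partial>lborel) \<le> (\<integral>\<^sup>+x. f x \<partial>lebesgue_on D)" by simp
  qed
qed

abbreviation unif :: "real \<Rightarrow> real \<Rightarrow> real measure" where
  "unif p l \<equiv> uniform_measure lborel {p<..<p + l}"

lemma sets_unif [measurable_cong]: "sets (unif p l) = sets borel"
  by simp

lemma prob_space_unif: "0 < l \<Longrightarrow> prob_space (unif p l)"
  by (intro prob_space_uniform_measure) auto

lemma AE_unif: "AE x in unif p l. x \<in> {p<..<p + l}"
  by (intro AE_uniform_measureI) auto

lemma nn_integral_unif_le:
  assumes "0 < l" and [measurable]: "f \<in> borel_measurable borel"
  shows "(\<integral>\<^sup>+x. f x \<partial>unif p l) \<le> ennreal (1 / l) * (\<integral>\<^sup>+x. f x \<partial>lborel)"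
proof -
  have "(\<integral>\<^sup>+x. f x \<partial>unif p l) = (\<integral>\<^sup>+x. f x * indicator {p<..<p + l} x \<partial>lborel) / emeasure lborel {p<..<p + l}"
    by (rule nn_integral_uniform_measure) auto
  also have "\<dots> = ennreal (1 / l) * (\<integral>\<^sup>+x. f x * indicator {p<..<p + l} x \<partial>lborel)"
    using assms by (simp add: divide_ennreal_def inverse_ennreal mult.commute inverse_eq_divide)
  also have "\<dots> \<le> ennreal (1 / l) * (\<integral>\<^sup>+x. f x \<partial>lborel)"
    by (intro mult_left_mono nn_integral_mono) (auto simp: indicator_def)
  finally show ?thesis .
qed

text \<open>Each mean is at most the reciprocal of the length times the integral over the whole
  line; by Tonelli the three integrals combine into one over space.\<close>

lemma nn_integral_unif3_le:
  fixes K :: "real \<times> real \<times> real \<Rightarrow> ennreal"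
  assumes l: "0 < l1" "0 < l2" "0 < l3" and [measurable]: "K \<in> borel_measurable borel"
    and K: "(\<integral>\<^sup>+x. K x \<partial>lborel) \<le> ennreal M" "0 \<le> M"
  shows "(\<integral>\<^sup>+x. \<integral>\<^sup>+y. \<integral>\<^sup>+z. K (x, y, z) \<partial>unif p3 l3 \<partial>unif p2 l2 \<partial>unif p1 l1) \<le> ennreal (M / (l1 * l2 * l3))"
proof -
  have "(\<integral>\<^sup>+x. \<integral>\<^sup>+y. \<integral>\<^sup>+z. K (x, y, z) \<partial>unif p3 l3 \<partial>unif p2 l2 \<partial>unif p1 l1)
    \<le> (\<integral>\<^sup>+x. \<integral>\<^sup>+y. ennreal (1 / l3) * (\<integral>\<^sup>+z. K (x, y, z) \<partial>lborel) \<partial>unif p2 l2 \<partial>unif p1 l1)"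
    by (intro nn_integral_mono nn_integral_unif_le l) measurable
  also have "\<dots> \<le> (\<integral>\<^sup>+x. ennreal (1 / l2) * (\<integral>\<^sup>+y. ennreal (1 / l3) * (\<integral>\<^sup>+z. K (x, y, z) \<partial>lborel) \<partial>lborel) \<partial>unif p1 l1)"
    by (intro nn_integral_mono nn_integral_unif_le l) measurable
  also have "\<dots> \<le> ennreal (1 / l1) * (\<integral>\<^sup>+x. ennreal (1 / l2) * (\<integral>\<^sup>+y. ennreal (1 / l3) * (\<integral>\<^sup>+z. K (x, y, z) \<partial>lborel) \<partial>lborel) \<partial>lborel)"
    by (intro nn_integral_unif_le l) measurable
  also have "\<dots> = ennreal (1 / l1) * (ennreal (1 / l2) * (ennreal (1 / l3) * (\<integral>\<^sup>+x. \<integral>\<^sup>+y. \<integral>\<^sup>+z. K (x, y, z) \<partial>lborel \<partial>lborel \<partial>lborel)))"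
    by (simp add: nn_integral_cmult)
  also have "(\<integral>\<^sup>+x. \<integral>\<^sup>+y. \<integral>\<^sup>+z. K (x, y, z) \<partial>lborel \<partial>lborel \<partial>lborel) = (\<integral>\<^sup>+x. K x \<partial>lborel)"
  \<comment> \<open>Tonelli is applied twice, since the triple product is nested to the
    right.\<close>
  proof -
    have "K \<in> borel_measurable (lborel \<Otimes>\<^sub>M (lborel :: (real \<times> real) measure))"
      by (simp add: lborel_prod)
    then have "(\<integral>\<^sup>+x. K x \<partial>lborel) = (\<integral>\<^sup>+x. \<integral>\<^sup>+w. K (x, w) \<partial>lborel \<partial>lborel)"
      using lborel.nn_integral_fst[of K lborel] by (simp add: lborel_prod)
    also have "\<dots> = (\<integral>\<^sup>+x. \<integral>\<^sup>+y. \<integral>\<^sup>+z. K (x, y, z) \<partial>lborel \<partial>lborel \<partial>lborel)"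
    proof (intro nn_integral_cong)
      fix x
      have "(\<lambda>w. K (x, w)) \<in> borel_measurable (lborel \<Otimes>\<^sub>M (lborel :: real measure))"
        by (simp add: lborel_prod)
      from lborel.nn_integral_fst[OF this]
      show "(\<integral>\<^sup>+w. K (x, w) \<partial>lborel) = (\<integral>\<^sup>+y. \<integral>\<^sup>+z. K (x, y, z) \<partial>lborel \<partial>lborel)"
        by (simp add: lborel_prod)
    qed
    finally show ?thesis by simp
  qed
  also have "ennreal (1 / l1) * (ennreal (1 / l2) * (ennreal (1 / l3) * (\<integral>\<^sup>+x. K x \<partial>lborel)))
    \<le> ennreal (1 / l1) * (ennreal (1 / l2) * (ennreal (1 / l3) * ennreal M))"
    by (intro mult_left_mono K) auto
  also have "\<dots> = ennreal (M / (l1 * l2 * l3))"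
    using l K(2) by (simp add: ennreal_mult[symmetric] mult_ac)
  finally show ?thesis .
qed

text \<open>Integrating in the order \<open>u1\<close>, \<open>v1\<close>, \<open>u2\<close>, \<open>v2\<close> makes each of the three terms constant in one
  or two of the nested integrals, so that no interchange of integrals is needed.\<close>

lemma mean_step:
  fixes h :: "real \<times> real \<Rightarrow> ennreal" and W1 W2 :: "real \<times> real \<times> real \<Rightarrow> ennreal"
  assumes l: "0 < l" "0 < l'" "0 < m" "0 < m'"
    and [measurable]: "h \<in> borel_measurable borel" "W1 \<in> borel_measurable borel" "W2 \<in> borel_measurable borel"
    and h: "\<And>u1 v1 u2 v2. u1 \<in> {p<..<p+l} \<Longrightarrow> v1 \<in> {p'<..<p'+l'} \<Longrightarrow> u2 \<in> {r<..<r+m} \<Longrightarrow> v2 \<in> {r'<..<r'+m'}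
      \<Longrightarrow> h (u1, u2) \<le> h (v1, v2) + W1 (u1, v1, u2) + W2 (v1, u2, v2)"
  shows "(\<integral>\<^sup>+u1. \<integral>\<^sup>+u2. h (u1, u2) \<partial>unif r m \<partial>unif p l)
    \<le> (\<integral>\<^sup>+v1. \<integral>\<^sup>+v2. h (v1, v2) \<partial>unif r' m' \<partial>unif p' l')
      + (\<integral>\<^sup>+u1. \<integral>\<^sup>+v1. \<integral>\<^sup>+u2. W1 (u1, v1, u2) \<partial>unif r m \<partial>unif p' l' \<partial>unif p l)
      + (\<integral>\<^sup>+v1. \<integral>\<^sup>+u2. \<integral>\<^sup>+v2. W2 (v1, u2, v2) \<partial>unif r' m' \<partial>unif r m \<partial>unif p' l')"
proof -
  interpret P: prob_space "unif p l" by (rule prob_space_unif) fact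
  interpret P': prob_space "unif p' l'" by (rule prob_space_unif) fact
  interpret R: prob_space "unif r m" by (rule prob_space_unif) fact
  interpret R': prob_space "unif r' m'" by (rule prob_space_unif) fact
  have one: "emeasure (unif p l) UNIV = 1" "emeasure (unif p' l') UNIV = 1"
      "emeasure (unif r m) UNIV = 1" "emeasure (unif r' m') UNIV = 1"
    using P.emeasure_space_1 P'.emeasure_space_1 R.emeasure_space_1 R'.emeasure_space_1 by simp_all
  \<comment> \<open>All four measures are probability measures, so averaging over the absent
    variables \<open>v1\<close> and \<open>v2\<close> changes nothing.\<close>
  have "(\<integral>\<^sup>+u1. \<integral>\<^sup>+u2. h (u1, u2) \<partial>unif r m \<partial>unif p l)
    = (\<integral>\<^sup>+u1. \<integral>\<^sup>+v1. \<integral>\<^sup>+u2. \<integral>\<^sup>+v2. h (u1, u2) \<partial>unif r' m' \<partial>unif r m \<partial>unif p' l' \<partial>unif p l)"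
    by (simp del: emeasure_uniform_measure add: one)
  also have "\<dots> \<le> (\<integral>\<^sup>+u1. \<integral>\<^sup>+v1. \<integral>\<^sup>+u2. \<integral>\<^sup>+v2. (h (v1, v2) + W1 (u1, v1, u2) + W2 (v1, u2, v2))
       \<partial>unif r' m' \<partial>unif r m \<partial>unif p' l' \<partial>unif p l)"
    \<comment> \<open>Working inwards, each variable may be assumed to lie in its own interval,
      which has full measure; then \<open>h\<close> applies.\<close>
    apply (intro nn_integral_mono_AE)
    using AE_unif[of p l] apply eventually_elim
    apply (intro nn_integral_mono_AE)
    using AE_unif[of p' l'] apply eventually_elim
    apply (intro nn_integral_mono_AE)
    using AE_unif[of r m] apply eventually_elim
    apply (intro nn_integral_mono_AE)
    using AE_unif[of r' m'] apply eventually_elim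
    by (rule h)
  also have "\<dots> = (\<integral>\<^sup>+v1. \<integral>\<^sup>+v2. h (v1, v2) \<partial>unif r' m' \<partial>unif p' l')
      + (\<integral>\<^sup>+u1. \<integral>\<^sup>+v1. \<integral>\<^sup>+u2. W1 (u1, v1, u2) \<partial>unif r m \<partial>unif p' l' \<partial>unif p l)
      + (\<integral>\<^sup>+v1. \<integral>\<^sup>+u2. \<integral>\<^sup>+v2. W2 (v1, u2, v2) \<partial>unif r' m' \<partial>unif r m \<partial>unif p' l')"
    by (simp del: emeasure_uniform_measure add: one nn_integral_add)
  finally show ?thesis .
qed

section \<open>One step of the chain\<close>

text \<open>Either \<open>x\<close> is at most \<open>c\<close>, or
  \<open>(x / c) powr (q - 1)\<close> is at least 1 and \<open>x\<close> is at most its product with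
  this power. The bound is linear in \<open>x powr q\<close> and so can be averaged directly;
  \<open>c\<close> stays free.\<close>

lemma young_scaled:
  fixes x c q :: real
  assumes "0 \<le> x" "0 < c" "1 \<le> q"
  shows "x \<le> c + c powr (1 - q) * x powr q"
proof (cases "x \<le> c")
  case True
  then show ?thesis by (simp add: add_increasing2)
next
  case False
  then have "c powr (q - 1) \<le> x powr (q - 1)"
    using assms by (intro powr_mono2) auto
  then have "1 \<le> c powr (1 - q) * x powr (q - 1)"
    using assms False by (simp add: powr_diff field_simps)
  then have "x * 1 \<le> x * (c powr (1 - q) * x powr (q - 1))"
    using assms by (intro mult_left_mono) auto
  also have "\<dots> = c powr (1 - q) * x powr q"
    using assms False by (simp add: powr_diff field_simps)
  finally show ?thesis using assms by simp
qed

text \<open>The scale \<open>c = B powr (1 / q)\<close> makes the two terms of Young's bound equal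
  when the mean of the \<open>q\<close>-th power is at most \<open>B\<close>. This gives Hoelder's
  bound for the mean up to the factor 2.\<close>

lemma optimal_scale:
  fixes B q :: real
  assumes "0 < B" "1 \<le> q"
  shows "B powr (1 / q) + (B powr (1 / q)) powr (1 - q) * B = 2 * B powr (1 / q)"
proof -
  have "(B powr (1 / q)) powr (1 - q) * B powr 1 = B powr (1 / q)"
    unfolding powr_powr powr_add[symmetric] using assms by (simp add: field_simps)
  then show ?thesis using assms by simp
qed

text \<open>On the hyperplane \<open>e \<bullet> x = 0\<close> the integrand is \<open>0\<close>, as \<open>x / 0 = 0\<close>, and says nothing about \<open>A\<close>;
  since the hyperplane is a null set, \<open>K\<close> can be made infinite there.\<close>

lemma kernel_majorant:
  fixes A :: "'a::euclidean_space \<Rightarrow> real"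
  assumes D: "D \<in> sets borel" and A: "A \<in> borel_measurable (lebesgue_on D)"
    and e: "e \<noteq> 0" and q: "1 \<le> q" and \<beta>: "0 \<le> \<beta>"
    and M: "(\<integral>\<^sup>+x. ennreal (\<bar>A x\<bar> powr q / \<bar>e \<bullet> x\<bar> powr \<beta>) \<partial>lebesgue_on D) \<le> ennreal M"
  obtains K where "K \<in> borel_measurable borel" "(\<integral>\<^sup>+x. K x \<partial>lborel) \<le> ennreal M"
    "\<And>x c \<sigma>. x \<in> D \<Longrightarrow> 0 < c \<Longrightarrow> 0 < \<sigma> \<Longrightarrow> \<bar>e \<bullet> x\<bar> \<le> \<sigma> \<Longrightarrow>
       ennreal \<bar>A x\<bar> \<le> ennreal c + ennreal (c powr (1 - q) * \<sigma> powr \<beta>) * K x"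
proof -
  have [measurable]: "(\<lambda>x. e \<bullet> x) \<in> borel_measurable (lebesgue_on D)"
    by (intro measurable_restrict_space1 measurable_completion) simp
  have "negligible {x. e \<bullet> x = 0}"
    using e by (intro negligible_hyperplane) auto
  moreover have "(\<lambda>x. ennreal (\<bar>A x\<bar> powr q / \<bar>e \<bullet> x\<bar> powr \<beta>)) \<in> borel_measurable (lebesgue_on D)"
    using A by measurable
  ultimately obtain K where K: "K \<in> borel_measurable borel"
    "\<And>x. x \<in> D \<Longrightarrow> ennreal (\<bar>A x\<bar> powr q / \<bar>e \<bullet> x\<bar> powr \<beta>) \<le> K x"
    "\<And>x. x \<in> {x. e \<bullet> x = 0} \<Longrightarrow> K x = \<infinity>"
    "(\<integral>\<^sup>+x. K x \<partial>lborel) \<le> (\<integral>\<^sup>+x. ennreal (\<bar>A x\<bar> powr q / \<bar>e \<bullet> x\<bar> powr \<beta>) \<partial>lebesgue_on D)"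
    using borel_majorant[OF D] by blast
  show thesis
  proof
    show "K \<in> borel_measurable borel" "(\<integral>\<^sup>+x. K x \<partial>lborel) \<le> ennreal M"
      using K M by auto
    fix x and c \<sigma> :: real assume x: "x \<in> D" "0 < c" "0 < \<sigma>" "\<bar>e \<bullet> x\<bar> \<le> \<sigma>"
    show "ennreal \<bar>A x\<bar> \<le> ennreal c + ennreal (c powr (1 - q) * \<sigma> powr \<beta>) * K x"
    proof (cases "e \<bullet> x = 0")
      case True
      then show ?thesis
        using x by (simp add: K(3) ennreal_mult_top)
    next
      case False
      let ?d = "\<bar>e \<bullet> x\<bar>"
      have "\<bar>A x\<bar> \<le> c + c powr (1 - q) * \<bar>A x\<bar> powr q"
        using x q by (intro young_scaled) auto
      \<comment> \<open>The singular denominator of the integrand is inserted here, and its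
        compensating numerator is then bounded by means of \<open>\<sigma>\<close>.\<close>
      also have "\<bar>A x\<bar> powr q = ?d powr \<beta> * (\<bar>A x\<bar> powr q / ?d powr \<beta>)"
        using False by simp
      also have "c powr (1 - q) * \<dots> \<le> c powr (1 - q) * (\<sigma> powr \<beta> * (\<bar>A x\<bar> powr q / ?d powr \<beta>))"
        using x \<beta> by (intro mult_left_mono mult_right_mono powr_mono2) auto
      finally have "\<bar>A x\<bar> \<le> c + c powr (1 - q) * \<sigma> powr \<beta> * (\<bar>A x\<bar> powr q / ?d powr \<beta>)"
        by (simp add: mult_ac)
      then have "ennreal \<bar>A x\<bar> \<le> ennreal (c + c powr (1 - q) * \<sigma> powr \<beta> * (\<bar>A x\<bar> powr q / ?d powr \<beta>))"
        by (rule ennreal_leI)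
      also have "\<dots> = ennreal c + ennreal (c powr (1 - q) * \<sigma> powr \<beta>) * ennreal (\<bar>A x\<bar> powr q / ?d powr \<beta>)"
        using x by (simp add: ennreal_plus ennreal_mult[symmetric] del: times_divide_eq_right)
      also have "\<dots> \<le> ennreal c + ennreal (c powr (1 - q) * \<sigma> powr \<beta>) * K x"
        by (intro add_left_mono mult_left_mono K x) auto
      finally show ?thesis .
    qed
  qed
qed

lemma nn_integral_unif3_affine_le:
  fixes K :: "'i \<Rightarrow> real \<times> real \<times> real \<Rightarrow> ennreal"
  assumes l: "0 < l1" "0 < l2" "0 < l3"
    and K: "\<And>j. j \<in> F \<Longrightarrow> K j \<in> borel_measurable borel"
      "\<And>j. j \<in> F \<Longrightarrow> (\<integral>\<^sup>+x. K j x \<partial>lborel) \<le> ennreal (M j)"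
    and nn: "\<And>j. j \<in> F \<Longrightarrow> 0 \<le> M j" "\<And>j. j \<in> F \<Longrightarrow> 0 \<le> c j" "\<And>j. j \<in> F \<Longrightarrow> 0 \<le> k j"
  shows "(\<integral>\<^sup>+x. \<integral>\<^sup>+y. \<integral>\<^sup>+z. (\<Sum>j\<in>F. ennreal (c j) + ennreal (k j) * K j (x, y, z)) \<partial>unif p3 l3 \<partial>unif p2 l2 \<partial>unif p1 l1)
    \<le> ennreal (\<Sum>j\<in>F. c j + k j * (M j / (l1 * l2 * l3)))"
proof -
  interpret P1: prob_space "unif p1 l1" by (rule prob_space_unif) fact
  interpret P2: prob_space "unif p2 l2" by (rule prob_space_unif) fact
  interpret P3: prob_space "unif p3 l3" by (rule prob_space_unif) fact
  have one: "emeasure (unif p1 l1) UNIV = 1" "emeasure (unif p2 l2) UNIV = 1" "emeasure (unif p3 l3) UNIV = 1"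
    using P1.emeasure_space_1 P2.emeasure_space_1 P3.emeasure_space_1 by simp_all
  \<comment> \<open>Extending by 0 makes every member of the family measurable, with no membership
    condition to carry along.\<close>
  define K' where "K' j = (if j \<in> F then K j else (\<lambda>_. 0))" for j
  have [measurable]: "K' j \<in> borel_measurable borel" for j
    using K(1) by (simp add: K'_def)
  have "(\<integral>\<^sup>+x. \<integral>\<^sup>+y. \<integral>\<^sup>+z. (\<Sum>j\<in>F. ennreal (c j) + ennreal (k j) * K j (x, y, z)) \<partial>unif p3 l3 \<partial>unif p2 l2 \<partial>unif p1 l1)
    = (\<integral>\<^sup>+x. \<integral>\<^sup>+y. \<integral>\<^sup>+z. (\<Sum>j\<in>F. ennreal (c j) + ennreal (k j) * K' j (x, y, z)) \<partial>unif p3 l3 \<partial>unif p2 l2 \<partial>unif p1 l1)"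
    by (intro nn_integral_cong sum.cong) (auto simp: K'_def)
  also have "\<dots> = (\<Sum>j\<in>F. ennreal (c j) + ennreal (k j) *
      (\<integral>\<^sup>+x. \<integral>\<^sup>+y. \<integral>\<^sup>+z. K' j (x, y, z) \<partial>unif p3 l3 \<partial>unif p2 l2 \<partial>unif p1 l1))"
    by (simp del: emeasure_uniform_measure add: one nn_integral_add nn_integral_sum nn_integral_cmult)
  also have "\<dots> \<le> (\<Sum>j\<in>F. ennreal (c j) + ennreal (k j) * ennreal (M j / (l1 * l2 * l3)))"
  proof (intro sum_mono add_left_mono mult_left_mono)
    fix j assume "j \<in> F"
    then show "(\<integral>\<^sup>+x. \<integral>\<^sup>+y. \<integral>\<^sup>+z. K' j (x, y, z) \<partial>unif p3 l3 \<partial>unif p2 l2 \<partial>unif p1 l1) \<le> ennreal (M j / (l1 * l2 * l3))"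
      using K nn l by (intro nn_integral_unif3_le) (auto simp: K'_def)
  qed auto
  also have "\<dots> = (\<Sum>j\<in>F. ennreal (c j + k j * (M j / (l1 * l2 * l3))))"
    using nn l by (intro sum.cong refl) (simp add: ennreal_plus ennreal_mult[symmetric] del: times_divide_eq_right)
  also have "\<dots> = ennreal (\<Sum>j\<in>F. c j + k j * (M j / (l1 * l2 * l3)))"
    using nn l by (intro sum_ennreal) auto
  finally show ?thesis .
qed

text \<open>Each kernel receives its own Young scale, chosen so that after averaging the two terms
  in its bound balance. That accounts for the factor 2 and the roots in the conclusion.\<close>

lemma mean_step_bound:
  fixes h :: "real \<times> real \<Rightarrow> ennreal" and A1 :: "'i \<Rightarrow> real \<times> real \<times> real \<Rightarrow> real" 
    and A2 :: "'j \<Rightarrow> real \<times> real \<times> real \<Rightarrow> real"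
    and K1 :: "'i \<Rightarrow> real \<times> real \<times> real \<Rightarrow> ennreal" and K2 :: "'j \<Rightarrow> real \<times> real \<times> real \<Rightarrow> ennreal" 
  assumes l: "0 < l" "0 < l'" "0 < m" "0 < m'" and \<sigma>: "0 < \<sigma>" "0 < \<tau>"
    and h: "h \<in> borel_measurable borel"
    and K1: "\<And>j. j \<in> F1 \<Longrightarrow> K1 j \<in> borel_measurable borel" "\<And>j. j \<in> F1 \<Longrightarrow> (\<integral>\<^sup>+x. K1 j x \<partial>lborel) \<le> ennreal (M1 j)"
    and K2: "\<And>j. j \<in> F2 \<Longrightarrow> K2 j \<in> borel_measurable borel" "\<And>j. j \<in> F2 \<Longrightarrow> (\<integral>\<^sup>+x. K2 j x \<partial>lborel) \<le> ennreal (M2 j)"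
    and M: "\<And>j. j \<in> F1 \<Longrightarrow> 0 < M1 j" "\<And>j. j \<in> F2 \<Longrightarrow> 0 < M2 j"
    and q: "\<And>j. j \<in> F1 \<Longrightarrow> 1 \<le> q1 j" "\<And>j. j \<in> F2 \<Longrightarrow> 1 \<le> q2 j"
    and h_le: "\<And>u1 v1 u2 v2. u1 \<in> {p<..<p+l} \<Longrightarrow> v1 \<in> {p'<..<p'+l'} \<Longrightarrow> u2 \<in> {r<..<r+m} \<Longrightarrow> v2 \<in> {r'<..<r'+m'}
      \<Longrightarrow> h (u1, u2) \<le> h (v1, v2) + (\<Sum>j\<in>F1. ennreal \<bar>A1 j (u1, v1, u2)\<bar>) + (\<Sum>j\<in>F2. ennreal \<bar>A2 j (v1, u2, v2)\<bar>)"
    and A1: "\<And>j u1 v1 u2 c. j \<in> F1 \<Longrightarrow> u1 \<in> {p<..<p+l} \<Longrightarrow> v1 \<in> {p'<..<p'+l'} \<Longrightarrow> u2 \<in> {r<..<r+m} \<Longrightarrow> 0 < c \<Longrightarrow>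
      ennreal \<bar>A1 j (u1, v1, u2)\<bar> \<le> ennreal c + ennreal (c powr (1 - q1 j) * \<sigma> powr \<beta>1 j) * K1 j (u1, v1, u2)"
    and A2: "\<And>j v1 u2 v2 c. j \<in> F2 \<Longrightarrow> v1 \<in> {p'<..<p'+l'} \<Longrightarrow> u2 \<in> {r<..<r+m} \<Longrightarrow> v2 \<in> {r'<..<r'+m'} \<Longrightarrow> 0 < c \<Longrightarrow>
      ennreal \<bar>A2 j (v1, u2, v2)\<bar> \<le> ennreal c + ennreal (c powr (1 - q2 j) * \<tau> powr \<beta>2 j) * K2 j (v1, u2, v2)"
  shows "(\<integral>\<^sup>+u1. \<integral>\<^sup>+u2. h (u1, u2) \<partial>unif r m \<partial>unif p l)
    \<le> (\<integral>\<^sup>+v1. \<integral>\<^sup>+v2. h (v1, v2) \<partial>unif r' m' \<partial>unif p' l')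
      + ennreal (\<Sum>j\<in>F1. 2 * (\<sigma> powr \<beta>1 j * (M1 j / (l * l' * m))) powr (1 / q1 j))
      + ennreal (\<Sum>j\<in>F2. 2 * (\<tau> powr \<beta>2 j * (M2 j / (l' * m * m'))) powr (1 / q2 j))"
proof -
  \<comment> \<open>The number under the root bounds \<open>\<sigma> powr \<beta>1 j\<close> times
    the mean of \<open>K1 j\<close>, so \<open>c1 j\<close> is the scale of
    \<open>optimal_scale\<close>. It is positive because \<open>M1 j\<close> is.\<close>
  define c1 where "c1 j = (\<sigma> powr \<beta>1 j * (M1 j / (l * l' * m))) powr (1 / q1 j)" for j
  define c2 where "c2 j = (\<tau> powr \<beta>2 j * (M2 j / (l' * m * m'))) powr (1 / q2 j)" for j
  define W1 where "W1 w = (\<Sum>j\<in>F1. ennreal (c1 j) + ennreal (c1 j powr (1 - q1 j) * \<sigma> powr \<beta>1 j) * K1 j w)" for w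
  define W2 where "W2 w = (\<Sum>j\<in>F2. ennreal (c2 j) + ennreal (c2 j powr (1 - q2 j) * \<tau> powr \<beta>2 j) * K2 j w)" for w
  have c1: "0 < c1 j" if "j \<in> F1" for j
    using l \<sigma> M that unfolding c1_def by (simp add: less_imp_neq[symmetric])
  have c2: "0 < c2 j" if "j \<in> F2" for j
    using l \<sigma> M that unfolding c2_def by (simp add: less_imp_neq[symmetric])
  have [measurable]: "W1 \<in> borel_measurable borel" "W2 \<in> borel_measurable borel"
    using K1(1) K2(1) unfolding W1_def W2_def by measurable
  have "(\<integral>\<^sup>+u1. \<integral>\<^sup>+u2. h (u1, u2) \<partial>unif r m \<partial>unif p l)
    \<le> (\<integral>\<^sup>+v1. \<integral>\<^sup>+v2. h (v1, v2) \<partial>unif r' m' \<partial>unif p' l')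
      + (\<integral>\<^sup>+u1. \<integral>\<^sup>+v1. \<integral>\<^sup>+u2. W1 (u1, v1, u2) \<partial>unif r m \<partial>unif p' l' \<partial>unif p l)
      + (\<integral>\<^sup>+v1. \<integral>\<^sup>+u2. \<integral>\<^sup>+v2. W2 (v1, u2, v2) \<partial>unif r' m' \<partial>unif r m \<partial>unif p' l')"
  proof (intro mean_step l h)
    fix u1 v1 u2 v2
    assume u: "u1 \<in> {p<..<p+l}" "v1 \<in> {p'<..<p'+l'}" "u2 \<in> {r<..<r+m}" "v2 \<in> {r'<..<r'+m'}"
    have "h (u1, u2) \<le> h (v1, v2) + (\<Sum>j\<in>F1. ennreal \<bar>A1 j (u1, v1, u2)\<bar>) + (\<Sum>j\<in>F2. ennreal \<bar>A2 j (v1, u2, v2)\<bar>)"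
      by (rule h_le) fact+
    also have "\<dots> \<le> h (v1, v2) + W1 (u1, v1, u2) + W2 (v1, u2, v2)"
      unfolding W1_def W2_def by (intro add_mono order_refl sum_mono A1 A2 u c1 c2)
    finally show "h (u1, u2) \<le> h (v1, v2) + W1 (u1, v1, u2) + W2 (v1, u2, v2)" .
  qed measurable
  also have "(\<integral>\<^sup>+u1. \<integral>\<^sup>+v1. \<integral>\<^sup>+u2. W1 (u1, v1, u2) \<partial>unif r m \<partial>unif p' l' \<partial>unif p l)
    \<le> ennreal (\<Sum>j\<in>F1. c1 j + c1 j powr (1 - q1 j) * \<sigma> powr \<beta>1 j * (M1 j / (l * l' * m)))"
    unfolding W1_def by (intro nn_integral_unif3_affine_le l K1) (auto intro: less_imp_le M c1)
  also have "(\<Sum>j\<in>F1. c1 j + c1 j powr (1 - q1 j) * \<sigma> powr \<beta>1 j * (M1 j / (l * l' * m)))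
    = (\<Sum>j\<in>F1. 2 * (\<sigma> powr \<beta>1 j * (M1 j / (l * l' * m))) powr (1 / q1 j))"
    unfolding c1_def mult.assoc using l \<sigma> M q by (intro sum.cong refl optimal_scale) auto
  also have "(\<integral>\<^sup>+v1. \<integral>\<^sup>+u2. \<integral>\<^sup>+v2. W2 (v1, u2, v2) \<partial>unif r' m' \<partial>unif r m \<partial>unif p' l')
    \<le> ennreal (\<Sum>j\<in>F2. c2 j + c2 j powr (1 - q2 j) * \<tau> powr \<beta>2 j * (M2 j / (l' * m * m')))"
    unfolding W2_def by (intro nn_integral_unif3_affine_le l K2) (auto intro: less_imp_le M c2)
  also have "(\<Sum>j\<in>F2. c2 j + c2 j powr (1 - q2 j) * \<tau> powr \<beta>2 j * (M2 j / (l' * m * m')))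
    = (\<Sum>j\<in>F2. 2 * (\<tau> powr \<beta>2 j * (M2 j / (l' * m * m'))) powr (1 / q2 j))"
    unfolding c2_def mult.assoc using l \<sigma> M q by (intro sum.cong refl optimal_scale) auto
  finally show ?thesis by (simp add: add_mono)
qed

section \<open>Choice of scales\<close>

text \<open>If neither side of \<open>x\<close> had room for length \<open>r\<close>, there would be
  points outside \<open>I\<close> on both sides at distance less than \<open>r\<close>. By
  connectedness \<open>I\<close> would lie between them and have length at most
  \<open>2 * r\<close>. No centring at \<open>x\<close> is required, so endpoints of
  \<open>I\<close> cause no trouble.\<close>

lemma one_sided_subinterval:
  fixes I :: "real set"
  assumes I: "is_interval I" and x: "x \<in> I" and r: "0 < r" "ennreal (2 * r) < emeasure lborel I"
  obtains p where "{p<..<p + r} \<subseteq> I" "\<And>z. z \<in> {p<..<p + r} \<Longrightarrow> \<bar>z - x\<bar> \<le> r"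
proof -
  have "{x<..<x + r} \<subseteq> I \<or> {x - r<..<x} \<subseteq> I"
  proof (rule ccontr)
    assume "\<not> ?thesis"
    then obtain z1 z2 where "z1 \<in> {x<..<x + r}" "z1 \<notin> I" "z2 \<in> {x - r<..<x}" "z2 \<notin> I"
      by blast
    then have z: "x < z1" "z1 < x + r" "z1 \<notin> I" "x - r < z2" "z2 < x" "z2 \<notin> I"
      by auto
    have "I \<subseteq> {z2..z1}"
    proof
      fix y assume "y \<in> I"
      have mem: "z \<in> I" if "u \<in> I" "v \<in> I" "u \<le> z" "z \<le> v" for u v z
        using I that unfolding is_interval_1 by blast
      have "z2 \<le> y"
        using mem[of y x z2] \<open>y \<in> I\<close> x z by force
      moreover have "y \<le> z1"
        using mem[of x y z1] \<open>y \<in> I\<close> x z by force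
      ultimately show "y \<in> {z2..z1}" by simp
    qed
    then have "emeasure lborel I \<le> emeasure lborel {z2..z1}"
      by (intro emeasure_mono) auto
    also have "\<dots> = ennreal (z1 - z2)" using z by simp
    also have "\<dots> \<le> ennreal (2 * r)" using z by (intro ennreal_leI) auto
    finally show False using r by simp
  qed
  then show thesis
  proof
    assume "{x<..<x + r} \<subseteq> I"
    then show thesis by (intro that[of x]) auto
  next
    assume "{x - r<..<x} \<subseteq> I"
    then show thesis by (intro that[of "x - r"]) auto
  qed
qed

lemma interval_dist_le_measure:
  fixes I :: "real set"
  assumes I: "is_interval I" "I \<in> sets borel" and xy: "x \<in> I" "y \<in> I"
  shows "ennreal \<bar>x - y\<bar> \<le> emeasure lborel I"
proof -
  have sub: "closed_segment x y \<subseteq> I"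
    using I xy by (intro closed_segment_subset) (simp_all add: is_interval_convex)
  have "ennreal \<bar>x - y\<bar> = emeasure lborel (closed_segment x y)"
    by (simp add: closed_segment_eq_real_ivl)
  also have "\<dots> \<le> emeasure lborel I"
    using I sub by (intro emeasure_mono) simp_all
  finally show ?thesis .
qed

text \<open>The factor \<open>\<kappa>\<close> shrinks the first rectangle until it fits into the
  domain. It must depend only on the lengths and on \<open>a\<close>, \<open>b\<close>, since it
  enters the final constant. For infinite lengths 1 will do; for finite ones the two maxima are
  bounded by \<open>m1\<close> and \<open>m2\<close>. With exactly one infinite length, one maximum
  would be unbounded against a finite length and no \<open>\<kappa>\<close> could work.\<close>

lemma scale_factor_ex:
  fixes L1 L2 :: ennreal
  assumes "L1 = \<infinity> \<longleftrightarrow> L2 = \<infinity>" "0 < L1" "0 < L2" "0 < a" "0 < b"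
  obtains \<kappa> :: real where "0 < \<kappa>" "\<kappa> \<le> 1"
    "\<And>X Y. 0 \<le> X \<Longrightarrow> 0 \<le> Y \<Longrightarrow> ennreal X \<le> L1 \<Longrightarrow> ennreal Y \<le> L2 \<Longrightarrow>
       ennreal (2 * (\<kappa> * max X (Y powr a))) < L1 \<and> ennreal (2 * (\<kappa> * max Y (X powr b))) < L2"
proof (cases "L1 = \<infinity>")
  case True
  then show thesis using assms by (intro that[of 1]) auto
next
  case False
  obtain l1 where l1: "L1 = ennreal l1" "0 < l1"
    using False assms by (cases L1) auto
  obtain l2 where l2: "L2 = ennreal l2" "0 < l2"
    using False assms by (cases L2) auto
  define m1 where "m1 = max l1 (l2 powr a)"
  define m2 where "m2 = max l2 (l1 powr b)"
  have m: "0 < m1" "0 < m2" using l1 l2 by (auto simp: m1_def m2_def)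
  \<comment> \<open>The 4 leaves room for the factor 2 in the claim and for strict
    inequality.\<close>
  define \<kappa> where "\<kappa> = min 1 (min (l1 / (4 * m1)) (l2 / (4 * m2)))"
  have \<kappa>: "0 < \<kappa>" "\<kappa> \<le> 1" using m l1 l2 by (auto simp: \<kappa>_def)
  show thesis
  proof (intro that[of \<kappa>] \<kappa>)
    fix X Y assume XY: "0 \<le> X" "0 \<le> Y" "ennreal X \<le> L1" "ennreal Y \<le> L2"
    then have XY': "X \<le> l1" "Y \<le> l2" using l1 l2 by auto
    have "max X (Y powr a) \<le> m1"
      unfolding m1_def using XY XY' assms by (intro max.mono powr_mono2) auto
    then have "\<kappa> * max X (Y powr a) \<le> l1 / (4 * m1) * m1"
      using \<kappa> l1 m by (intro mult_mono) (auto simp: \<kappa>_def XY le_max_iff_disj)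
    then have 1: "2 * (\<kappa> * max X (Y powr a)) < l1" using m l1 by simp
    have "max Y (X powr b) \<le> m2"
      unfolding m2_def using XY XY' assms by (intro max.mono powr_mono2) auto
    then have "\<kappa> * max Y (X powr b) \<le> l2 / (4 * m2) * m2"
      using \<kappa> l2 m by (intro mult_mono) (auto simp: \<kappa>_def XY le_max_iff_disj)
    then have 2: "2 * (\<kappa> * max Y (X powr b)) < l2" using m l2 by simp
    show "ennreal (2 * (\<kappa> * max X (Y powr a))) < L1 \<and> ennreal (2 * (\<kappa> * max Y (X powr b))) < L2"
      using 1 2 l1 l2 \<kappa> XY by (auto simp: ennreal_less_iff le_max_iff_disj)
  qed
qed

text \<open>Since \<open>0 powr e = 0\<close> even for \<open>e \<le> 0\<close>, a summand with base \<open>0\<close> on the right is no help.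
  It is not needed: \<open>X\<close> is positive if \<open>X\<close> is the larger scale, and \<open>Y\<close> is positive otherwise.\<close>

lemma max_scale_powr_le:
  fixes X Y a b \<beta> q :: real
  assumes X: "0 \<le> X" "0 \<le> Y" "X \<noteq> 0 \<or> Y \<noteq> 0" and q: "1 \<le> q"
  shows "((max X (Y powr a)) powr (\<beta> - 2) / max Y (X powr b)) powr (1 / q)
    \<le> X powr ((\<beta> - 2 - b) / q) + Y powr (((\<beta> - 2) * a - 1) / q)"
proof (cases "Y powr a \<le> X")
  case True
  have X': "0 < X"
  proof (rule ccontr)
    assume "\<not> 0 < X"
    with X have "X = 0" "0 < Y" by auto
    moreover from \<open>0 < Y\<close> have "0 < Y powr a" by simp
    ultimately show False using True by linarith
  qed
  \<comment> \<open>Of the maximum in the denominator, the member in the same variable as the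
    numerator is kept, so that a single power remains. The other case does the same with
    \<open>Y\<close>.\<close>
  have "(max X (Y powr a)) powr (\<beta> - 2) / max Y (X powr b) \<le> X powr (\<beta> - 2) / X powr b"
    using True X' by (intro frac_le) auto
  also have "\<dots> = X powr (\<beta> - 2 - b)" by (simp add: powr_diff)
  finally have "((max X (Y powr a)) powr (\<beta> - 2) / max Y (X powr b)) powr (1 / q) \<le> (X powr (\<beta> - 2 - b)) powr (1 / q)"
    using X q by (intro powr_mono2) (auto simp: le_max_iff_disj)
  then show ?thesis using X q by (simp add: powr_powr add_increasing2)
next
  case False
  with X have Y': "0 < Y" by (cases "Y = 0") auto
  have "(max X (Y powr a)) powr (\<beta> - 2) / max Y (X powr b) \<le> (Y powr a) powr (\<beta> - 2) / Y"
    using False Y' by (intro frac_le) auto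
  also have "\<dots> = Y powr ((\<beta> - 2) * a - 1)" using Y' powr_diff[of Y "(\<beta> - 2) * a" 1] by (simp add: powr_powr mult.commute)
  finally have "((max X (Y powr a)) powr (\<beta> - 2) / max Y (X powr b)) powr (1 / q) \<le> (Y powr ((\<beta> - 2) * a - 1)) powr (1 / q)"
    using X q by (intro powr_mono2) (auto simp: le_max_iff_disj)
  then show ?thesis using X q by (simp add: powr_powr add_increasing)
qed

text \<open>The numerator is the \<open>0\<close>-th error term of the chain, with the powers of \<open>M\<close>, \<open>s\<close>, \<open>t\<close> taken out,
  and the denominator comes from the geometric series.\<close>

definition chain_const :: "real \<Rightarrow> real \<Rightarrow> real \<Rightarrow> real \<Rightarrow> real \<Rightarrow> real" where
  "chain_const \<kappa> d q \<beta> e = 2 * (4 powr \<beta> * d / \<kappa> ^ 3) powr (1 / q) / (1 - (1/2) powr (e / q))"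

section \<open>Geometric decay of the error terms\<close>

lemma half_powr_power: "((1/2::real) powr x) ^ n = (1/2) powr (x * n)"
  by (simp add: powr_powr flip: powr_realpow)

text \<open>Two of the three lengths in the denominator lie in the first direction, so
  \<open>w powr (\<beta> - 2) / v\<close> remains, with \<open>w\<close> and \<open>v\<close> the
  current side lengths up to \<open>\<kappa>\<close>. It decays with rate \<open>\<beta> - 2\<close>
  from \<open>w\<close>, reduced by \<open>\<theta>\<close> from \<open>v\<close>. The constant 2
  comes from the halved length at step \<open>Suc n\<close>.\<close>

lemma scale_term1:
  fixes s t \<kappa> M \<mu> \<theta> \<beta> q :: real
  assumes "0 < s" "0 < t" "0 < \<kappa>" "0 < M"
    and \<mu>_def: "\<mu> = (1/2) powr \<theta>"
  shows "((4 * (s * (1/2) ^ n)) powr \<beta> * (M / (\<kappa> * s * (1/2) ^ n * (\<kappa> * s * (1/2) ^ Suc n) * (\<kappa> * t * \<mu> ^ n)))) powr (1 / q)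
    = (4 powr \<beta> * 2 / \<kappa> ^ 3) powr (1 / q) * (M powr (1 / q) * (s powr (\<beta> - 2) / t) powr (1 / q)) * ((1/2) powr ((\<beta> - 2 - \<theta>) / q)) ^ n"
proof -
  define w where "w = s * (1/2) ^ n"
  define v where "v = t * \<mu> ^ n"
  have w: "0 < w" "0 < v" using assms by (auto simp: w_def v_def)
  have "(4 * w) powr \<beta> * (M / (\<kappa> * w * (\<kappa> * w / 2) * (\<kappa> * v))) = 4 powr \<beta> * 2 / \<kappa> ^ 3 * (M * (w powr (\<beta> - 2) / v))"
    using w assms by (simp add: powr_mult powr_diff field_simps power2_eq_square power3_eq_cube)
  also have "w powr (\<beta> - 2) / v = s powr (\<beta> - 2) / t * (1/2) powr ((\<beta> - 2 - \<theta>) * n)"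
  proof -
    have "w powr (\<beta> - 2) = s powr (\<beta> - 2) * (1/2) powr ((\<beta> - 2) * n)"
      unfolding w_def using assms by (simp add: powr_mult powr_powr mult.commute flip: powr_realpow)
    moreover have "v = t * (1/2) powr (\<theta> * n)"
      unfolding v_def \<mu>_def half_powr_power ..
    ultimately show ?thesis by (simp add: left_diff_distrib powr_diff)
  qed
  finally have "((4 * w) powr \<beta> * (M / (\<kappa> * w * (\<kappa> * w / 2) * (\<kappa> * v)))) powr (1 / q) =
     (4 powr \<beta> * 2 / \<kappa> ^ 3) powr (1 / q) * (M powr (1 / q) * ((s powr (\<beta> - 2) / t) powr (1 / q) * ((1/2) powr ((\<beta> - 2 - \<theta>) * n)) powr (1 / q)))"
    using assms by (simp add: powr_mult del: times_divide_eq_right times_divide_eq_left)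
  then show ?thesis
    unfolding half_powr_power powr_powr w_def v_def by (simp add: mult_ac)
qed

text \<open>Here two lengths lie in the second direction, which leaves
  \<open>v powr (\<beta> - 2) / w\<close>: the rate is \<open>\<theta> * (\<beta> - 2)\<close>,
  reduced by 1 from \<open>w\<close>. The constant \<open>2 / \<mu>\<close> arises because both
  lengths taken at step \<open>Suc n\<close> are smaller, by 1/2 and by
  \<open>\<mu>\<close>.\<close>

lemma scale_term2:
  fixes s t \<kappa> M \<mu> \<theta> \<beta> q :: real
  assumes "0 < s" "0 < t" "0 < \<kappa>" "0 < M"
    and \<mu>_def: "\<mu> = (1/2) powr \<theta>"
  shows "((4 * (t * \<mu> ^ n)) powr \<beta> * (M / (\<kappa> * s * (1/2) ^ Suc n * (\<kappa> * t * \<mu> ^ n) * (\<kappa> * t * \<mu> ^ Suc n)))) powr (1 / q)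
    = (4 powr \<beta> * (2 / \<mu>) / \<kappa> ^ 3) powr (1 / q) * (M powr (1 / q) * (t powr (\<beta> - 2) / s) powr (1 / q)) * ((1/2) powr ((\<theta> * (\<beta> - 2) - 1) / q)) ^ n"
proof -
  define w where "w = s * (1/2) ^ n"
  define v where "v = t * \<mu> ^ n"
  have w: "0 < w" "0 < v" "0 < \<mu>" using assms by (auto simp: w_def v_def)
  have "(4 * v) powr \<beta> * (M / (\<kappa> * w / 2 * (\<kappa> * v) * (\<kappa> * v * \<mu>))) = 4 powr \<beta> * (2 / \<mu>) / \<kappa> ^ 3 * (M * (v powr (\<beta> - 2) / w))"
    using w assms(1-4) by (simp add: powr_mult powr_diff field_simps power2_eq_square power3_eq_cube)
  also have "v powr (\<beta> - 2) / w = t powr (\<beta> - 2) / s * (1/2) powr ((\<theta> * (\<beta> - 2) - 1) * n)"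
  proof -
    have "v powr (\<beta> - 2) = t powr (\<beta> - 2) * (1/2) powr (\<theta> * (\<beta> - 2) * n)"
      unfolding v_def \<mu>_def half_powr_power using assms by (simp add: powr_mult powr_powr mult_ac)
    moreover have "w = s * (1/2) powr n"
      unfolding w_def by (simp add: powr_realpow)
    ultimately show ?thesis by (simp add: left_diff_distrib powr_diff)
  qed
  finally have "((4 * v) powr \<beta> * (M / (\<kappa> * w / 2 * (\<kappa> * v) * (\<kappa> * v * \<mu>)))) powr (1 / q) =
     (4 powr \<beta> * (2 / \<mu>) / \<kappa> ^ 3) powr (1 / q) * (M powr (1 / q) * ((t powr (\<beta> - 2) / s) powr (1 / q) * ((1/2) powr ((\<theta> * (\<beta> - 2) - 1) * n)) powr (1 / q)))"
    using assms(1-4) w by (simp add: powr_mult del: times_divide_eq_right times_divide_eq_left)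
  then show ?thesis
    unfolding half_powr_power powr_powr w_def v_def by (simp add: mult_ac)
qed

lemma sum_power_le:
  fixes \<rho> :: real
  assumes "0 \<le> \<rho>" "\<rho> < 1"
  shows "(\<Sum>k<n. \<rho> ^ k) \<le> 1 / (1 - \<rho>)"
  using assms by (simp add: sum_gp_strict divide_right_mono)

section \<open>The chain of shrinking rectangles\<close>

text \<open>The interval containing \<open>z\<close> is the image of \<open>{p<..<p + l}\<close>
  under the homothety with centre \<open>x\<close> and ratio \<open>\<rho>\<close>. Convexity of
  \<open>I\<close> keeps the image inside, and distances to the centre are multiplied by
  \<open>\<rho>\<close>.\<close>

lemma homothety_interval:
  fixes x :: real
  assumes I: "is_interval I" "x \<in> I" and \<rho>: "0 < \<rho>" "\<rho> \<le> 1"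
    and sub: "{p<..<p + l} \<subseteq> I" and near: "\<And>z. z \<in> {p<..<p + l} \<Longrightarrow> \<bar>z - x\<bar> \<le> d"
    and z: "z \<in> {x + \<rho> * (p - x)<..<x + \<rho> * (p - x) + l * \<rho>}"
  shows "z \<in> I" "\<bar>z - x\<bar> \<le> d * \<rho>"
proof -
  \<comment> \<open>The preimage of \<open>z\<close> under the homothety.\<close>
  define w where "w = x + (z - x) / \<rho>"
  have zw: "z = (1 - \<rho>) * x + \<rho> * w" using \<rho> by (simp add: w_def field_simps)
  have w: "w \<in> {p<..<p + l}"
    using z \<rho> by (simp add: w_def field_simps)
  have "(1 - \<rho>) *\<^sub>R x + \<rho> *\<^sub>R w \<in> I"
    using I w sub \<rho> by (intro convexD) (auto simp: is_interval_convex)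
  then show "z \<in> I" by (simp add: zw)
  have "z - x = \<rho> * (w - x)" by (simp add: zw algebra_simps)
  then show "\<bar>z - x\<bar> \<le> d * \<rho>"
    using near[OF w] \<rho> by (simp add: abs_mult mult.commute)
qed

text \<open>The number \<open>\<theta>\<close> is the contraction exponent of the second direction
  relative to the first; the last two assumptions say exactly that both decay rates are positive.
  The bounds are strictly positive so that the Young scales are positive; vanishing bounds are
  reached later by a limit.\<close>

locale two_scale_estimate =
  fixes I1 I2 :: "real set" and E :: "'e metric" and G :: "real \<times> real \<Rightarrow> 'e"
    and F1 F2 :: "nat set" and A1 A2 :: "nat \<Rightarrow> real \<times> real \<times> real \<Rightarrow> real"
    and q1 q2 \<beta>1 \<beta>2 M1 M2 :: "nat \<Rightarrow> real" and \<theta> :: real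
  assumes I: "is_interval I1" "I1 \<in> sets borel" "is_interval I2" "I2 \<in> sets borel"
    and cont: "continuous_map (top_of_set (I1 \<times> I2)) (mtopology_of E) G"
    and meas1: "j \<in> F1 \<Longrightarrow> A1 j \<in> borel_measurable (lebesgue_on (I1 \<times> I1 \<times> I2))"
    and meas2: "j \<in> F2 \<Longrightarrow> A2 j \<in> borel_measurable (lebesgue_on (I1 \<times> I2 \<times> I2))"
    and G_le: "\<lbrakk>x1 \<in> I1; x2 \<in> I2; y1 \<in> I1; y2 \<in> I2\<rbrakk> \<Longrightarrow>
       mdist E (G (x1, x2)) (G (y1, y2))
         \<le> (\<Sum>j\<in>F1. \<bar>A1 j (x1, y1, x2)\<bar>) + (\<Sum>j\<in>F2. \<bar>A2 j (y1, x2, y2)\<bar>)"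
    and M: "j \<in> F1 \<Longrightarrow> 0 < M1 j" "j \<in> F2 \<Longrightarrow> 0 < M2 j"
    and int1: "j \<in> F1 \<Longrightarrow>
       (\<integral>\<^sup>+ (u1, v1, u2). ennreal (\<bar>A1 j (u1, v1, u2)\<bar> powr q1 j / \<bar>u1 - v1\<bar> powr \<beta>1 j)
          \<partial>lebesgue_on (I1 \<times> I1 \<times> I2)) \<le> ennreal (M1 j)"
    and int2: "j \<in> F2 \<Longrightarrow>
       (\<integral>\<^sup>+ (v1, u2, v2). ennreal (\<bar>A2 j (v1, u2, v2)\<bar> powr q2 j / \<bar>u2 - v2\<bar> powr \<beta>2 j)
          \<partial>lebesgue_on (I1 \<times> I2 \<times> I2)) \<le> ennreal (M2 j)"
    and q: "j \<in> F1 \<Longrightarrow> 1 \<le> q1 j" "j \<in> F2 \<Longrightarrow> 1 \<le> q2 j"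
    and \<theta>: "0 < \<theta>"
    and \<beta>1: "j \<in> F1 \<Longrightarrow> \<theta> < \<beta>1 j - 2"
    and \<beta>2: "j \<in> F2 \<Longrightarrow> 1 < \<theta> * (\<beta>2 j - 2)"
begin

lemma \<beta>_pos: "j \<in> F1 \<Longrightarrow> 0 \<le> \<beta>1 j" "j \<in> F2 \<Longrightarrow> 0 \<le> \<beta>2 j"
proof -
  show "j \<in> F1 \<Longrightarrow> 0 \<le> \<beta>1 j" using \<beta>1[of j] \<theta> by linarith
  assume "j \<in> F2"
  then have "0 < \<theta> * (\<beta>2 j - 2)" using \<beta>2[of j] by linarith
  then show "0 \<le> \<beta>2 j" using \<theta> by (simp add: zero_less_mult_iff)
qed

lemma kernel1:
  assumes "j \<in> F1"
  shows "\<exists>K. K \<in> borel_measurable borel \<and> (\<integral>\<^sup>+x. K x \<partial>lborel) \<le> ennreal (M1 j) \<and>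
    (\<forall>u\<in>I1. \<forall>v\<in>I1. \<forall>w\<in>I2. \<forall>c \<sigma>. 0 < c \<longrightarrow> 0 < \<sigma> \<longrightarrow> \<bar>u - v\<bar> \<le> \<sigma> \<longrightarrow>
       ennreal \<bar>A1 j (u, v, w)\<bar> \<le> ennreal c + ennreal (c powr (1 - q1 j) * \<sigma> powr \<beta>1 j) * K (u, v, w))"
proof -
  \<comment> \<open>The vector \<open>(1, -1, 0)\<close> turns the difference of the first two
    coordinates into the linear form that \<open>kernel_majorant\<close> expects.\<close>
  have eq: "(\<lambda>x. ennreal (\<bar>A1 j x\<bar> powr q1 j / \<bar>(1, -1, 0) \<bullet> x\<bar> powr \<beta>1 j)) =
      (\<lambda>(u1, v1, u2). ennreal (\<bar>A1 j (u1, v1, u2)\<bar> powr q1 j / \<bar>u1 - v1\<bar> powr \<beta>1 j))"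
    by (auto simp: fun_eq_iff inner_Pair)
  obtain K where K: "K \<in> borel_measurable borel" "(\<integral>\<^sup>+x. K x \<partial>lborel) \<le> ennreal (M1 j)"
    "\<And>x c \<sigma>. x \<in> I1 \<times> I1 \<times> I2 \<Longrightarrow> 0 < c \<Longrightarrow> 0 < \<sigma> \<Longrightarrow> \<bar>(1, -1, 0) \<bullet> x\<bar> \<le> \<sigma> \<Longrightarrow>
       ennreal \<bar>A1 j x\<bar> \<le> ennreal c + ennreal (c powr (1 - q1 j) * \<sigma> powr \<beta>1 j) * K x"
    using kernel_majorant[of "I1 \<times> I1 \<times> I2" "A1 j" "(1, -1, 0)" "q1 j" "\<beta>1 j" "M1 j"]
      assms I meas1 q \<beta>_pos int1 by (auto simp: eq borel_Times zero_prod_def)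
  from K(3)[of "(_, _, _)"] K(1,2) show ?thesis
    by (intro exI[of _ K]) (simp add: inner_Pair)
qed

lemma kernel2:
  assumes "j \<in> F2"
  shows "\<exists>K. K \<in> borel_measurable borel \<and> (\<integral>\<^sup>+x. K x \<partial>lborel) \<le> ennreal (M2 j) \<and>
    (\<forall>w\<in>I1. \<forall>u\<in>I2. \<forall>v\<in>I2. \<forall>c \<sigma>. 0 < c \<longrightarrow> 0 < \<sigma> \<longrightarrow> \<bar>u - v\<bar> \<le> \<sigma> \<longrightarrow>
       ennreal \<bar>A2 j (w, u, v)\<bar> \<le> ennreal c + ennreal (c powr (1 - q2 j) * \<sigma> powr \<beta>2 j) * K (w, u, v))"
proof -
  have eq: "(\<lambda>x. ennreal (\<bar>A2 j x\<bar> powr q2 j / \<bar>(0, 1, -1) \<bullet> x\<bar> powr \<beta>2 j)) =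
      (\<lambda>(v1, u2, v2). ennreal (\<bar>A2 j (v1, u2, v2)\<bar> powr q2 j / \<bar>u2 - v2\<bar> powr \<beta>2 j))"
    by (auto simp: fun_eq_iff inner_Pair)
  obtain K where K: "K \<in> borel_measurable borel" "(\<integral>\<^sup>+x. K x \<partial>lborel) \<le> ennreal (M2 j)"
    "\<And>x c \<sigma>. x \<in> I1 \<times> I2 \<times> I2 \<Longrightarrow> 0 < c \<Longrightarrow> 0 < \<sigma> \<Longrightarrow> \<bar>(0, 1, -1) \<bullet> x\<bar> \<le> \<sigma> \<Longrightarrow>
       ennreal \<bar>A2 j x\<bar> \<le> ennreal c + ennreal (c powr (1 - q2 j) * \<sigma> powr \<beta>2 j) * K x"
    using kernel_majorant[of "I1 \<times> I2 \<times> I2" "A2 j" "(0, 1, -1)" "q2 j" "\<beta>2 j" "M2 j"]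
      assms I meas2 q \<beta>_pos int2 by (auto simp: eq borel_Times zero_prod_def)
  from K(3)[of "(_, _, _)"] K(1,2) show ?thesis
    by (intro exI[of _ K]) (simp add: inner_Pair)
qed

section \<open>The distance of \<open>G\<close> from its value at a fixed point\<close>

lemma G_in: "x1 \<in> I1 \<Longrightarrow> x2 \<in> I2 \<Longrightarrow> G (x1, x2) \<in> mspace E"
  using cont by (auto simp: continuous_map_def Pi_iff)

text \<open>Nothing is known about \<open>G\<close> outside the domain; the cut-off by the indicator
  makes the distance a Borel function on the whole plane.\<close>

definition gap :: "real \<times> real \<Rightarrow> real \<times> real \<Rightarrow> real" where
  "gap x u = indicator (I1 \<times> I2) u *\<^sub>R mdist E (G x) (G u)"

lemma gap_cont: 
  assumes "x \<in> I1 \<times> I2"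
  shows "continuous_on (I1 \<times> I2) (\<lambda>u. mdist E (G x) (G u))"
proof -
  have "continuous_map (top_of_set (I1 \<times> I2)) euclidean (\<lambda>u. mdist E (G x) (G u))"
    using assms G_in cont by (intro continuous_map_mdist) auto
  then show ?thesis by simp
qed

lemma gap_measurable [measurable]:
  assumes "x \<in> I1 \<times> I2"
  shows "gap x \<in> borel_measurable borel"
  unfolding gap_def using assms I
  by (intro borel_measurable_continuous_on_indicator gap_cont borel_Times) auto

text \<open>The sum of all error terms of a chain whose first rectangle has sides
  \<open>\<kappa> * s\<close> and \<open>\<kappa> * t\<close>, with the geometric series already
  summed.\<close>

definition scale_bound :: "real \<Rightarrow> real \<Rightarrow> real \<Rightarrow> real" where
  "scale_bound \<kappa> s t =
     (\<Sum>j\<in>F1. chain_const \<kappa> 2 (q1 j) (\<beta>1 j) (\<beta>1 j - 2 - \<theta>) *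
        (M1 j powr (1 / q1 j) * (s powr (\<beta>1 j - 2) / t) powr (1 / q1 j)))
   + (\<Sum>j\<in>F2. chain_const \<kappa> (2 / (1/2) powr \<theta>) (q2 j) (\<beta>2 j) (\<theta> * (\<beta>2 j - 2) - 1) *
        (M2 j powr (1 / q2 j) * (t powr (\<beta>2 j - 2) / s) powr (1 / q2 j)))"

lemma scale_bound_nonneg: 
  assumes "0 < s" "0 < t" "0 < \<kappa>"
  shows "0 \<le> scale_bound \<kappa> s t"
proof -
  have "(1/2::real) powr (e / q') \<le> 1" if "0 < e" "1 \<le> q'" for e q'
    using powr_mono'[of 0 "e / q'" "1/2::real"] that by simp
  then show ?thesis
    using assms \<beta>1 \<beta>2 q unfolding scale_bound_def chain_const_def
    by (intro add_nonneg_nonneg sum_nonneg mult_nonneg_nonneg divide_nonneg_nonneg) auto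
qed

text \<open>Telescoping bounds \<open>D 0\<close> by \<open>D n\<close> plus the first
  \<open>n\<close> errors. The error sums are bounded uniformly in \<open>n\<close>, and
  \<open>D n\<close> becomes arbitrarily small because \<open>G\<close> is continuous at the
  centre.\<close>

lemma mean_gap_le:
  assumes x: "x1 \<in> I1" "x2 \<in> I2" and st: "0 < s" "0 < t" "0 < \<kappa>"
    and S: "{p<..<p + \<kappa> * s} \<subseteq> I1" "\<And>z. z \<in> {p<..<p + \<kappa> * s} \<Longrightarrow> \<bar>z - x1\<bar> \<le> 2 * s"
    and T: "{r<..<r + \<kappa> * t} \<subseteq> I2" "\<And>z. z \<in> {r<..<r + \<kappa> * t} \<Longrightarrow> \<bar>z - x2\<bar> \<le> 2 * t"
  shows "(\<integral>\<^sup>+u1. \<integral>\<^sup>+u2. ennreal (gap (x1, x2) (u1, u2)) \<partial>unif r (\<kappa> * t) \<partial>unif p (\<kappa> * s))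
    \<le> ennreal (scale_bound \<kappa> s t)"
proof -
  define \<mu> where "\<mu> = (1/2::real) powr \<theta>"
  have \<mu>: "0 < \<mu>" "\<mu> < 1"
    using \<theta> powr_less_mono'[of "1/2::real" 0 \<theta>] by (auto simp: \<mu>_def)
  \<comment> \<open>Left endpoints of the homothetic images of the two initial intervals; the ratios
    are 1/2 in the first direction and \<open>\<mu>\<close> in the second.\<close>
  define p' where "p' n = x1 + (1/2) ^ n * (p - x1)" for n
  define r' where "r' n = x2 + \<mu> ^ n * (r - x2)" for n
  define l where "l n = \<kappa> * s * (1/2) ^ n" for n
  define m where "m n = \<kappa> * t * \<mu> ^ n" for n
  have lm: "0 < l n" "0 < m n" for n using st \<mu> by (auto simp: l_def m_def)
  have S': "z \<in> I1" "\<bar>z - x1\<bar> \<le> 2 * s * (1/2) ^ n" if "z \<in> {p' n<..<p' n + l n}" for z n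
    using homothety_interval[OF I(1) x(1) _ _ S, of "(1/2) ^ n" z] that
    by (simp_all add: p'_def l_def power_le_one)
  have T': "z \<in> I2" "\<bar>z - x2\<bar> \<le> 2 * t * \<mu> ^ n" if "z \<in> {r' n<..<r' n + m n}" for z n
    using homothety_interval[OF I(3) x(2) _ _ T, of "\<mu> ^ n" z] that \<mu>
    by (simp_all add: r'_def m_def power_le_one)
  define D where "D n = (\<integral>\<^sup>+u1. \<integral>\<^sup>+u2. ennreal (gap (x1, x2) (u1, u2)) \<partial>unif (r' n) (m n) \<partial>unif (p' n) (l n))" for n
  define \<rho>1 where "\<rho>1 j = (1/2::real) powr ((\<beta>1 j - 2 - \<theta>) / q1 j)" for j
  define \<rho>2 where "\<rho>2 j = (1/2::real) powr ((\<theta> * (\<beta>2 j - 2) - 1) / q2 j)" for j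
  define c1 where "c1 j = 2 * ((4 powr \<beta>1 j * 2 / \<kappa> ^ 3) powr (1 / q1 j) *
     (M1 j powr (1 / q1 j) * (s powr (\<beta>1 j - 2) / t) powr (1 / q1 j)))" for j
  define c2 where "c2 j = 2 * ((4 powr \<beta>2 j * (2 / \<mu>) / \<kappa> ^ 3) powr (1 / q2 j) *
     (M2 j powr (1 / q2 j) * (t powr (\<beta>2 j - 2) / s) powr (1 / q2 j)))" for j
  have c: "0 \<le> c1 j" "0 \<le> c2 j" for j by (auto simp: c1_def c2_def)
  have \<rho>1: "0 \<le> \<rho>1 j" "\<rho>1 j < 1" if "j \<in> F1" for j
    using powr_less_mono'[of "1/2::real" 0 "(\<beta>1 j - 2 - \<theta>) / q1 j"] \<beta>1[OF that] q(1)[OF that]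
    by (auto simp: \<rho>1_def)
  have \<rho>2: "0 \<le> \<rho>2 j" "\<rho>2 j < 1" if "j \<in> F2" for j
    using powr_less_mono'[of "1/2::real" 0 "(\<theta> * (\<beta>2 j - 2) - 1) / q2 j"] \<beta>2[OF that] q(2)[OF that]
    by (auto simp: \<rho>2_def)
  define e where "e n = (\<Sum>j\<in>F1. c1 j * \<rho>1 j ^ n) + (\<Sum>j\<in>F2. c2 j * \<rho>2 j ^ n)" for n
  have e_nn: "0 \<le> e n" for n
    unfolding e_def using c \<rho>1 \<rho>2 by (intro add_nonneg_nonneg sum_nonneg mult_nonneg_nonneg) auto
  obtain K1 where K1: "\<And>j. j \<in> F1 \<Longrightarrow> K1 j \<in> borel_measurable borel"
    "\<And>j. j \<in> F1 \<Longrightarrow> (\<integral>\<^sup>+x. K1 j x \<partial>lborel) \<le> ennreal (M1 j)"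
    "\<And>j u v w c \<sigma>. j \<in> F1 \<Longrightarrow> u \<in> I1 \<Longrightarrow> v \<in> I1 \<Longrightarrow> w \<in> I2 \<Longrightarrow> 0 < c \<Longrightarrow> 0 < \<sigma> \<Longrightarrow> \<bar>u - v\<bar> \<le> \<sigma> \<Longrightarrow>
       ennreal \<bar>A1 j (u, v, w)\<bar> \<le> ennreal c + ennreal (c powr (1 - q1 j) * \<sigma> powr \<beta>1 j) * K1 j (u, v, w)"
    using kernel1 by metis
  obtain K2 where K2: "\<And>j. j \<in> F2 \<Longrightarrow> K2 j \<in> borel_measurable borel"
    "\<And>j. j \<in> F2 \<Longrightarrow> (\<integral>\<^sup>+x. K2 j x \<partial>lborel) \<le> ennreal (M2 j)"
    "\<And>j u v w c \<sigma>. j \<in> F2 \<Longrightarrow> w \<in> I1 \<Longrightarrow> u \<in> I2 \<Longrightarrow> v \<in> I2 \<Longrightarrow> 0 < c \<Longrightarrow> 0 < \<sigma> \<Longrightarrow> \<bar>u - v\<bar> \<le> \<sigma> \<Longrightarrow>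
       ennreal \<bar>A2 j (w, u, v)\<bar> \<le> ennreal c + ennreal (c powr (1 - q2 j) * \<sigma> powr \<beta>2 j) * K2 j (w, u, v)"
    using kernel2 by metis
  have step: "D n \<le> D (Suc n) + ennreal (e n)" for n
  proof -
    let ?\<sigma> = "4 * (s * (1/2) ^ n)" and ?\<tau> = "4 * (t * \<mu> ^ n)"
    have "D n \<le> D (Suc n)
      + ennreal (\<Sum>j\<in>F1. 2 * (?\<sigma> powr \<beta>1 j * (M1 j / (l n * l (Suc n) * m n))) powr (1 / q1 j))
      + ennreal (\<Sum>j\<in>F2. 2 * (?\<tau> powr \<beta>2 j * (M2 j / (l (Suc n) * m n * m (Suc n)))) powr (1 / q2 j))"
      unfolding D_def
    proof (rule mean_step_bound[where ?K1.0 = K1 and ?K2.0 = K2 and ?A1.0 = A1 and ?A2.0 = A2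
          and h = "\<lambda>u. ennreal (gap (x1, x2) u)"])
      have "gap (x1, x2) \<in> borel_measurable borel" using x by (intro gap_measurable) auto
      then show "(\<lambda>u. ennreal (gap (x1, x2) u)) \<in> borel_measurable borel" by measurable
      fix u1 v1 u2 v2 assume u: "u1 \<in> {p' n<..<p' n + l n}" "v1 \<in> {p' (Suc n)<..<p' (Suc n) + l (Suc n)}"
        "u2 \<in> {r' n<..<r' n + m n}" "v2 \<in> {r' (Suc n)<..<r' (Suc n) + m (Suc n)}"
      note mem = S'(1)[OF u(1)] S'(1)[OF u(2)] T'(1)[OF u(3)] T'(1)[OF u(4)]
      have "mdist E (G (x1, x2)) (G (u1, u2)) \<le> mdist E (G (x1, x2)) (G (v1, v2)) + mdist E (G (v1, v2)) (G (u1, u2))"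
        using mem x by (intro mdist_triangle G_in)
      \<comment> \<open>The point \<open>u\<close> of the larger rectangle must come first, so that
        the kernels appear with the arguments that \<open>mean_step_bound\<close>
        integrates.\<close>
      also have "mdist E (G (v1, v2)) (G (u1, u2)) = mdist E (G (u1, u2)) (G (v1, v2))"
        by (rule mdist_commute)
      also have "\<dots> \<le> (\<Sum>j\<in>F1. \<bar>A1 j (u1, v1, u2)\<bar>) + (\<Sum>j\<in>F2. \<bar>A2 j (v1, u2, v2)\<bar>)"
        using mem by (intro G_le)
      finally have "gap (x1, x2) (u1, u2) \<le> gap (x1, x2) (v1, v2) +
         (\<Sum>j\<in>F1. \<bar>A1 j (u1, v1, u2)\<bar>) + (\<Sum>j\<in>F2. \<bar>A2 j (v1, u2, v2)\<bar>)"
        using mem by (simp add: gap_def)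
      then have "ennreal (gap (x1, x2) (u1, u2)) \<le> ennreal (gap (x1, x2) (v1, v2) +
         (\<Sum>j\<in>F1. \<bar>A1 j (u1, v1, u2)\<bar>) + (\<Sum>j\<in>F2. \<bar>A2 j (v1, u2, v2)\<bar>))"
        by (rule ennreal_leI)
      also have "\<dots> = ennreal (gap (x1, x2) (v1, v2)) +
         (\<Sum>j\<in>F1. ennreal \<bar>A1 j (u1, v1, u2)\<bar>) + (\<Sum>j\<in>F2. ennreal \<bar>A2 j (v1, u2, v2)\<bar>)"
        by (simp add: gap_def ennreal_plus sum_nonneg sum_ennreal)
      finally show "ennreal (gap (x1, x2) (u1, u2)) \<le> ennreal (gap (x1, x2) (v1, v2)) +
         (\<Sum>j\<in>F1. ennreal \<bar>A1 j (u1, v1, u2)\<bar>) + (\<Sum>j\<in>F2. ennreal \<bar>A2 j (v1, u2, v2)\<bar>)" .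
    next
      fix j u1 v1 u2 and c :: real assume j: "j \<in> F1" and c: "0 < c" and 
        u: "u1 \<in> {p' n<..<p' n + l n}" "v1 \<in> {p' (Suc n)<..<p' (Suc n) + l (Suc n)}" "u2 \<in> {r' n<..<r' n + m n}"
      \<comment> \<open>Both points are within \<open>2 * s * (1/2) ^ n\<close> of
        \<open>x1\<close>, which explains the 4 in \<open>?\<sigma>\<close>; likewise for
        \<open>?\<tau>\<close>.\<close>
      have "2 * s * (1/2) ^ Suc n \<le> 2 * s * (1/2) ^ n" using st by simp
      then have "\<bar>u1 - v1\<bar> \<le> ?\<sigma>"
        using S'(2)[OF u(1)] S'(2)[OF u(2)] by linarith
      then show "ennreal \<bar>A1 j (u1, v1, u2)\<bar> \<le> ennreal c + ennreal (c powr (1 - q1 j) * ?\<sigma> powr \<beta>1 j) * K1 j (u1, v1, u2)"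
        using j c st by (intro K1(3) S'(1)[OF u(1)] S'(1)[OF u(2)] T'(1)[OF u(3)]) auto
    next
      fix j v1 u2 v2 and c :: real assume j: "j \<in> F2" and c: "0 < c" and 
        u: "v1 \<in> {p' (Suc n)<..<p' (Suc n) + l (Suc n)}" "u2 \<in> {r' n<..<r' n + m n}" "v2 \<in> {r' (Suc n)<..<r' (Suc n) + m (Suc n)}"
      have "2 * t * \<mu> ^ Suc n \<le> 2 * t * \<mu> ^ n" using st \<mu> by (intro mult_left_mono power_decreasing) auto
      then have "\<bar>u2 - v2\<bar> \<le> ?\<tau>"
        using T'(2)[OF u(2)] T'(2)[OF u(3)] by linarith
      then show "ennreal \<bar>A2 j (v1, u2, v2)\<bar> \<le> ennreal c + ennreal (c powr (1 - q2 j) * ?\<tau> powr \<beta>2 j) * K2 j (v1, u2, v2)"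
        using j c st \<mu> by (intro K2(3) S'(1)[OF u(1)] T'(1)[OF u(2)] T'(1)[OF u(3)]) auto
    qed (use lm st \<mu> K1 K2 M q in auto)
    also have "(\<Sum>j\<in>F1. 2 * (?\<sigma> powr \<beta>1 j * (M1 j / (l n * l (Suc n) * m n))) powr (1 / q1 j)) = (\<Sum>j\<in>F1. c1 j * \<rho>1 j ^ n)"
      unfolding l_def m_def c1_def \<rho>1_def
      by (intro sum.cong refl, subst scale_term1[OF st M(1) \<mu>_def]) (simp_all only: mult.assoc)
    also have "(\<Sum>j\<in>F2. 2 * (?\<tau> powr \<beta>2 j * (M2 j / (l (Suc n) * m n * m (Suc n)))) powr (1 / q2 j)) = (\<Sum>j\<in>F2. c2 j * \<rho>2 j ^ n)"
      unfolding l_def m_def c2_def \<rho>2_def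
      by (intro sum.cong refl, subst scale_term2[OF st M(2) \<mu>_def]) (simp_all only: mult.assoc)
    also have "D (Suc n) + ennreal (\<Sum>j\<in>F1. c1 j * \<rho>1 j ^ n) + ennreal (\<Sum>j\<in>F2. c2 j * \<rho>2 j ^ n) = D (Suc n) + ennreal (e n)"
      unfolding e_def using c \<rho>1 \<rho>2 by (subst ennreal_plus) (auto intro!: sum_nonneg simp: add.assoc)
    finally show ?thesis .
  qed
  have chain: "D 0 \<le> D n + ennreal (\<Sum>k<n. e k)" for n
  proof (induction n)
    case (Suc n)
    also have "D n + ennreal (\<Sum>k<n. e k) \<le> D (Suc n) + ennreal (e n) + ennreal (\<Sum>k<n. e k)"
      by (intro add_right_mono step)
    also have "\<dots> = D (Suc n) + ennreal (\<Sum>k<Suc n. e k)"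
      using e_nn by (simp add: ennreal_plus sum_nonneg add_ac)
    finally show ?case .
  qed simp
  have e_sum: "(\<Sum>k<n. e k) \<le> scale_bound \<kappa> s t" for n
  proof -
    have "(\<Sum>k<n. e k) = (\<Sum>j\<in>F1. c1 j * (\<Sum>k<n. \<rho>1 j ^ k)) + (\<Sum>j\<in>F2. c2 j * (\<Sum>k<n. \<rho>2 j ^ k))"
      unfolding e_def sum.distrib sum_distrib_left by (simp add: sum.swap[of _ "{..<n}"])
    also have "\<dots> \<le> (\<Sum>j\<in>F1. c1 j * (1 / (1 - \<rho>1 j))) + (\<Sum>j\<in>F2. c2 j * (1 / (1 - \<rho>2 j)))"
      using c \<rho>1 \<rho>2 by (intro add_mono sum_mono mult_left_mono sum_power_le) auto
    also have "\<dots> = scale_bound \<kappa> s t"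
      unfolding scale_bound_def chain_const_def c1_def c2_def \<rho>1_def \<rho>2_def \<mu>_def by (simp add: mult_ac)
    finally show ?thesis .
  qed
  have small: "\<exists>n. D n \<le> ennreal \<epsilon>" if \<epsilon>: "0 < \<epsilon>" for \<epsilon>
  proof -
    have "(x1, x2) \<in> I1 \<times> I2" using x by simp
    from gap_cont[OF this, unfolded continuous_on_iff, rule_format, OF this \<epsilon>]
    obtain d where d: "0 < d"
      "\<And>u. u \<in> I1 \<times> I2 \<Longrightarrow> dist u (x1, x2) < d \<Longrightarrow> dist (mdist E (G (x1, x2)) (G u)) (mdist E (G (x1, x2)) (G (x1, x2))) < \<epsilon>"
      by blast
    \<comment> \<open>This sequence bounds the distance from \<open>(x1, x2)\<close> to any point of
      the \<open>n\<close>-th rectangle, so some rectangle lies in the ball given by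
      continuity.\<close>
    have "(\<lambda>n. 2 * s * (1/2) ^ n + 2 * t * \<mu> ^ n) \<longlonglongrightarrow> 2 * s * 0 + 2 * t * 0"
      using \<mu> by (intro tendsto_intros LIMSEQ_power_zero) auto
    then have "eventually (\<lambda>n. 2 * s * (1/2) ^ n + 2 * t * \<mu> ^ n < d) sequentially"
      using d(1) by (intro order_tendstoD) auto
    then obtain n where n: "2 * s * (1/2) ^ n + 2 * t * \<mu> ^ n < d"
      by (auto simp: eventually_sequentially)
    interpret P: prob_space "unif (p' n) (l n)" by (rule prob_space_unif) (rule lm)
    interpret R: prob_space "unif (r' n) (m n)" by (rule prob_space_unif) (rule lm)
    have one: "emeasure (unif (p' n) (l n)) UNIV = 1" "emeasure (unif (r' n) (m n)) UNIV = 1"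
      using P.emeasure_space_1 R.emeasure_space_1 by simp_all
    have "D n \<le> (\<integral>\<^sup>+u1. \<integral>\<^sup>+u2. ennreal \<epsilon> \<partial>unif (r' n) (m n) \<partial>unif (p' n) (l n))"
      unfolding D_def
    proof (intro nn_integral_mono_AE)
      show "AE u1 in unif (p' n) (l n).
        (\<integral>\<^sup>+u2. ennreal (gap (x1, x2) (u1, u2)) \<partial>unif (r' n) (m n)) \<le> (\<integral>\<^sup>+u2. ennreal \<epsilon> \<partial>unif (r' n) (m n))"
        using AE_unif[of "p' n" "l n"]
      proof eventually_elim
        case u1: (elim u1)
        have "AE u2 in unif (r' n) (m n). ennreal (gap (x1, x2) (u1, u2)) \<le> ennreal \<epsilon>"
          using AE_unif[of "r' n" "m n"]
        proof eventually_elim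
          case u2: (elim u2)
          have "dist (u1, u2) (x1, x2) \<le> \<bar>u1 - x1\<bar> + \<bar>u2 - x2\<bar>"
            by (simp add: dist_Pair_Pair dist_real_def sqrt_sum_squares_le_sum_abs)
          also have "\<dots> < d" using n S'(2)[OF u1] T'(2)[OF u2] by linarith
          finally have "dist (mdist E (G (x1, x2)) (G (u1, u2))) (mdist E (G (x1, x2)) (G (x1, x2))) < \<epsilon>"
            using S'(1)[OF u1] T'(1)[OF u2] by (intro d(2)) auto
          moreover have "mdist E (G (x1, x2)) (G (x1, x2)) = 0"
            using G_in[OF x] by simp
          ultimately show ?case using S'(1)[OF u1] T'(1)[OF u2]
            by (intro ennreal_leI) (simp add: gap_def dist_real_def)
        qed
        then show ?case by (rule nn_integral_mono_AE)
      qed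
    qed
    also have "\<dots> = ennreal \<epsilon>" by (simp del: emeasure_uniform_measure add: one)
    finally show ?thesis ..
  qed
  have "D 0 \<le> ennreal (scale_bound \<kappa> s t)"
  proof (rule ennreal_le_epsilon)
    fix \<epsilon> :: real assume "0 < \<epsilon>"
    then obtain n where "D n \<le> ennreal \<epsilon>" using small by blast
    then have "D n + ennreal (\<Sum>k<n. e k) \<le> ennreal \<epsilon> + ennreal (scale_bound \<kappa> s t)"
      by (intro add_mono ennreal_leI e_sum)
    then show "D 0 \<le> ennreal (scale_bound \<kappa> s t) + ennreal \<epsilon>"
      using chain[of n] by (simp add: add.commute)
  qed
  then show ?thesis by (simp add: D_def p'_def r'_def l_def m_def)
qed

text \<open>The triangle inequality through \<open>u\<close> is averaged over one rectangle serving
  both points, and each of the two means is bounded by its own chain. The rectangle is placed next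
  to \<open>(x1, x2)\<close>; as \<open>\<kappa>\<close> is at most 1 and the coordinates differ by
  at most \<open>s\<close> and \<open>t\<close>, it is also within \<open>2 * s\<close> and
  \<open>2 * t\<close> of \<open>(y1, y2)\<close>.\<close>

lemma mdist_le_scale_bound:
  assumes x: "x1 \<in> I1" "x2 \<in> I2" "y1 \<in> I1" "y2 \<in> I2"
    and st: "0 < s" "0 < t" "0 < \<kappa>" "\<kappa> \<le> 1" "\<bar>x1 - y1\<bar> \<le> s" "\<bar>x2 - y2\<bar> \<le> t"
    and small: "ennreal (2 * (\<kappa> * s)) < emeasure lborel I1" "ennreal (2 * (\<kappa> * t)) < emeasure lborel I2"
  shows "mdist E (G (x1, x2)) (G (y1, y2)) \<le> 2 * scale_bound \<kappa> s t"
proof -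
  have \<kappa>: "0 < \<kappa> * s" "0 < \<kappa> * t" "\<kappa> * s \<le> s" "\<kappa> * t \<le> t" using st by auto
  obtain p where p: "{p<..<p + \<kappa> * s} \<subseteq> I1" "\<And>z. z \<in> {p<..<p + \<kappa> * s} \<Longrightarrow> \<bar>z - x1\<bar> \<le> \<kappa> * s"
    using one_sided_subinterval[OF I(1) x(1) \<kappa>(1) small(1)] by blast
  obtain r where r: "{r<..<r + \<kappa> * t} \<subseteq> I2" "\<And>z. z \<in> {r<..<r + \<kappa> * t} \<Longrightarrow> \<bar>z - x2\<bar> \<le> \<kappa> * t"
    using one_sided_subinterval[OF I(3) x(2) \<kappa>(2) small(2)] by blast
  interpret P: prob_space "unif p (\<kappa> * s)" by (rule prob_space_unif) fact
  interpret R: prob_space "unif r (\<kappa> * t)" by (rule prob_space_unif) fact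
  have one: "emeasure (unif p (\<kappa> * s)) UNIV = 1" "emeasure (unif r (\<kappa> * t)) UNIV = 1"
    using P.emeasure_space_1 R.emeasure_space_1 by simp_all
  let ?x = "(x1, x2)" and ?y = "(y1, y2)"
  have [measurable]: "gap ?x \<in> borel_measurable borel" "gap ?y \<in> borel_measurable borel"
    using x by (auto intro: gap_measurable)
  have nx: "\<bar>z - x1\<bar> \<le> 2 * s" "\<bar>z - y1\<bar> \<le> 2 * s" if "z \<in> {p<..<p + \<kappa> * s}" for z
    using p(2)[OF that] \<kappa> st by linarith+
  have ny: "\<bar>z - x2\<bar> \<le> 2 * t" "\<bar>z - y2\<bar> \<le> 2 * t" if "z \<in> {r<..<r + \<kappa> * t}" for z
    using r(2)[OF that] \<kappa> st by linarith+
  have "ennreal (mdist E (G ?x) (G ?y)) =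
      (\<integral>\<^sup>+u1. \<integral>\<^sup>+u2. ennreal (mdist E (G ?x) (G ?y)) \<partial>unif r (\<kappa> * t) \<partial>unif p (\<kappa> * s))"
    by (simp del: emeasure_uniform_measure add: one)
  also have "\<dots> \<le> (\<integral>\<^sup>+u1. \<integral>\<^sup>+u2. (ennreal (gap ?x (u1, u2)) + ennreal (gap ?y (u1, u2))) \<partial>unif r (\<kappa> * t) \<partial>unif p (\<kappa> * s))"
  proof (intro nn_integral_mono_AE)
    show "AE u1 in unif p (\<kappa> * s). (\<integral>\<^sup>+u2. ennreal (mdist E (G ?x) (G ?y)) \<partial>unif r (\<kappa> * t))
      \<le> (\<integral>\<^sup>+u2. (ennreal (gap ?x (u1, u2)) + ennreal (gap ?y (u1, u2))) \<partial>unif r (\<kappa> * t))"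
      using AE_unif[of p "\<kappa> * s"]
    proof eventually_elim
      case u1: (elim u1)
      have "AE u2 in unif r (\<kappa> * t). ennreal (mdist E (G ?x) (G ?y)) \<le> ennreal (gap ?x (u1, u2)) + ennreal (gap ?y (u1, u2))"
        using AE_unif[of r "\<kappa> * t"]
      proof eventually_elim
        case u2: (elim u2)
        have mem: "u1 \<in> I1" "u2 \<in> I2" using u1 u2 p r by auto
        have "mdist E (G ?x) (G ?y) \<le> mdist E (G ?x) (G (u1, u2)) + mdist E (G (u1, u2)) (G ?y)"
          using mem x by (intro mdist_triangle G_in)
        also have "\<dots> = gap ?x (u1, u2) + gap ?y (u1, u2)"
          using mem mdist_commute[of E] by (simp add: gap_def)
        finally have "ennreal (mdist E (G ?x) (G ?y)) \<le> ennreal (gap ?x (u1, u2) + gap ?y (u1, u2))"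
          by (rule ennreal_leI)
        then show ?case by (simp add: gap_def ennreal_plus)
      qed
      then show ?case by (rule nn_integral_mono_AE)
    qed
  qed
  also have "\<dots> = (\<integral>\<^sup>+u1. \<integral>\<^sup>+u2. ennreal (gap ?x (u1, u2)) \<partial>unif r (\<kappa> * t) \<partial>unif p (\<kappa> * s))
      + (\<integral>\<^sup>+u1. \<integral>\<^sup>+u2. ennreal (gap ?y (u1, u2)) \<partial>unif r (\<kappa> * t) \<partial>unif p (\<kappa> * s))"
    by (simp add: nn_integral_add)
  also have "\<dots> \<le> ennreal (scale_bound \<kappa> s t) + ennreal (scale_bound \<kappa> s t)"
    using x st p r nx ny by (intro add_mono mean_gap_le) auto
  also have "\<dots> = ennreal (2 * scale_bound \<kappa> s t)"
    using scale_bound_nonneg st by (simp add: ennreal_plus[symmetric])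
  finally show ?thesis
    using scale_bound_nonneg[of s t \<kappa>] st by (subst (asm) ennreal_le_iff) auto
qed

end

section \<open>The estimate\<close>

lemma nontrivial_interval_borel: "nontrivial_interval I \<Longrightarrow> I \<in> sets borel"
  by (auto simp: nontrivial_interval_def)

lemma nontrivial_interval_measure_pos:
  assumes "nontrivial_interval I"
  shows "0 < emeasure lborel I"
proof -
  obtain x y where xy: "x \<in> I" "y \<in> I" "x < y" and I: "is_interval I"
    using assms by (auto simp: nontrivial_interval_def)
  have "0 < ennreal \<bar>x - y\<bar>" using xy by simp
  also have "\<dots> \<le> emeasure lborel I"
    using xy I nontrivial_interval_borel[OF assms] by (intro interval_dist_le_measure)
  finally show ?thesis .
qed

text \<open>The order of quantifiers expresses what \<open>C\<close> may depend on: the intervals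
  enter only through their lengths \<open>L1\<close> and \<open>L2\<close>. That these are infinite
  together lets one factor \<open>\<kappa>\<close> serve all pairs of points.\<close>

theorem lemma2p1:
  fixes J1 J2 :: nat
    and q1 q2 \<beta>1 \<beta>2 :: "nat \<Rightarrow> real"
    and a b :: real
    and L1 L2 :: ennreal
  assumes "1 \<le> J1" and "1 \<le> J2"
    and "\<And>j. j \<in> {1..J1} \<Longrightarrow> 1 \<le> q1 j"
    and "\<And>j. j \<in> {1..J2} \<Longrightarrow> 1 \<le> q2 j"
    and "Min (\<beta>1 ` {1..J1}) > 2"
    and "Min (\<beta>2 ` {1..J2}) > 2"
    and "(Min (\<beta>1 ` {1..J1}) - 2) * (Min (\<beta>2 ` {1..J2}) - 2) - 1 > 0"
    and "a > 0" and "b > 0"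
    and "L1 = \<infinity> \<longleftrightarrow> L2 = \<infinity>"
  shows "\<exists>C::real. \<forall>(I1::real set) (I2::real set) (E::'e metric) (G::real \<times> real \<Rightarrow> 'e)
      (A1::nat \<Rightarrow> real \<times> real \<times> real \<Rightarrow> real) (A2::nat \<Rightarrow> real \<times> real \<times> real \<Rightarrow> real)
      (M1::nat \<Rightarrow> real) (M2::nat \<Rightarrow> real).
    nontrivial_interval I1 \<longrightarrow> nontrivial_interval I2 \<longrightarrow>
    emeasure lborel I1 = L1 \<longrightarrow> emeasure lborel I2 = L2 \<longrightarrow>
    continuous_map (top_of_set (I1 \<times> I2)) (mtopology_of E) G \<longrightarrow>
    (\<forall>j\<in>{1..J1}. A1 j \<in> borel_measurable (lebesgue_on (I1 \<times> I1 \<times> I2))) \<longrightarrow>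
    (\<forall>j\<in>{1..J2}. A2 j \<in> borel_measurable (lebesgue_on (I1 \<times> I2 \<times> I2))) \<longrightarrow>
    (\<forall>x1\<in>I1. \<forall>x2\<in>I2. \<forall>y1\<in>I1. \<forall>y2\<in>I2.
       mdist E (G (x1, x2)) (G (y1, y2))
         \<le> (\<Sum>j=1..J1. \<bar>A1 j (x1, y1, x2)\<bar>) + (\<Sum>j=1..J2. \<bar>A2 j (y1, x2, y2)\<bar>)) \<longrightarrow>
    (\<forall>j\<in>{1..J1}. 0 \<le> M1 j) \<longrightarrow> (\<forall>j\<in>{1..J2}. 0 \<le> M2 j) \<longrightarrow>
    (\<forall>j\<in>{1..J1}.
       (\<integral>\<^sup>+ (u1, v1, u2). ennreal (\<bar>A1 j (u1, v1, u2)\<bar> powr q1 j / \<bar>u1 - v1\<bar> powr \<beta>1 j)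
          \<partial>lebesgue_on (I1 \<times> I1 \<times> I2)) \<le> ennreal (M1 j)) \<longrightarrow>
    (\<forall>j\<in>{1..J2}.
       (\<integral>\<^sup>+ (v1, u2, v2). ennreal (\<bar>A2 j (v1, u2, v2)\<bar> powr q2 j / \<bar>u2 - v2\<bar> powr \<beta>2 j)
          \<partial>lebesgue_on (I1 \<times> I2 \<times> I2)) \<le> ennreal (M2 j)) \<longrightarrow>
    (\<forall>x1\<in>I1. \<forall>x2\<in>I2. \<forall>y1\<in>I1. \<forall>y2\<in>I2.
       mdist E (G (x1, x2)) (G (y1, y2))
         \<le> C * (\<Sum>j=1..J1. M1 j powr (1 / q1 j) *
                 (\<bar>x1 - y1\<bar> powr ((\<beta>1 j - 2 - b) / q1 j)
                  + \<bar>x2 - y2\<bar> powr (((\<beta>1 j - 2) * a - 1) / q1 j)))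
           + C * (\<Sum>j=1..J2. M2 j powr (1 / q2 j) *
                 (\<bar>x1 - y1\<bar> powr (((\<beta>2 j - 2) * b - 1) / q2 j)
                  + \<bar>x2 - y2\<bar> powr ((\<beta>2 j - 2 - a) / q2 j))))"
proof (cases "0 < L1 \<and> 0 < L2")
  case False
  \<comment> \<open>Nontrivial intervals have positive length, so here the claim is vacuous and any
    constant will do.\<close>
  then have "\<not> (nontrivial_interval I1 \<and> nontrivial_interval I2 \<and> emeasure lborel I1 = L1 \<and> emeasure lborel I2 = L2)"
    for I1 I2 using nontrivial_interval_measure_pos by blast
  then show ?thesis by (intro exI[of _ 0] allI impI) blast
next
  case True
  note q = assms(3,4)
  define B1 where "B1 = Min (\<beta>1 ` {1..J1}) - 2"
  define B2 where "B2 = Min (\<beta>2 ` {1..J2}) - 2"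
  have B: "0 < B1" "0 < B2" "1 < B1 * B2" using assms(5-7) by (auto simp: B1_def B2_def)
  then have "1 / B2 < B1" by (simp add: field_simps)
  \<comment> \<open>The hypothesis on the product of the exponents says precisely that this range is
    nonempty; its two ends are the two convergence conditions.\<close>
  then obtain \<theta> where \<theta>: "1 / B2 < \<theta>" "\<theta> < B1" using dense by blast
  from \<theta>(1) have \<theta>2: "1 < \<theta> * B2" using B by (simp add: field_simps)
  have \<theta>0: "0 < \<theta>" using \<theta>(1) B by (meson divide_pos_pos less_trans zero_less_one)
  have \<beta>1: "\<theta> < \<beta>1 j - 2" if "j \<in> {1..J1}" for j
  proof -
    have "Min (\<beta>1 ` {1..J1}) \<le> \<beta>1 j" using that by (intro Min_le) auto
    then show ?thesis using \<theta>(2) by (simp add: B1_def)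
  qed
  have \<beta>2: "1 < \<theta> * (\<beta>2 j - 2)" if "j \<in> {1..J2}" for j
  proof -
    have "Min (\<beta>2 ` {1..J2}) \<le> \<beta>2 j" using that by (intro Min_le) auto
    then have "\<theta> * B2 \<le> \<theta> * (\<beta>2 j - 2)" using \<theta>0 by (intro mult_left_mono) (auto simp: B2_def)
    then show ?thesis using \<theta>2 by linarith
  qed
  obtain \<kappa> :: real where \<kappa>: "0 < \<kappa>" "\<kappa> \<le> 1"
    "\<And>X Y. 0 \<le> X \<Longrightarrow> 0 \<le> Y \<Longrightarrow> ennreal X \<le> L1 \<Longrightarrow> ennreal Y \<le> L2 \<Longrightarrow>
       ennreal (2 * (\<kappa> * max X (Y powr a))) < L1 \<and> ennreal (2 * (\<kappa> * max Y (X powr b))) < L2"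
    using scale_factor_ex[of L1 L2 a b] assms True by metis
  define c1 where "c1 j = chain_const \<kappa> 2 (q1 j) (\<beta>1 j) (\<beta>1 j - 2 - \<theta>)" for j
  define c2 where "c2 j = chain_const \<kappa> (2 / (1/2) powr \<theta>) (q2 j) (\<beta>2 j) (\<theta> * (\<beta>2 j - 2) - 1)" for j
  have pow_le: "(1/2::real) powr (e / q') \<le> 1" if "0 < e" "1 \<le> q'" for e q'
    using powr_mono'[of 0 "e / q'" "1/2::real"] that by simp
  have c1: "0 \<le> c1 j" if "j \<in> {1..J1}" for j
    using pow_le[of "\<beta>1 j - 2 - \<theta>" "q1 j"] \<beta>1[OF that] q(1)[OF that] by (simp add: c1_def chain_const_def)
  have c2: "0 \<le> c2 j" if "j \<in> {1..J2}" for j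
    using pow_le[of "\<theta> * (\<beta>2 j - 2) - 1" "q2 j"] \<beta>2[OF that] q(2)[OF that] by (simp add: c2_def chain_const_def)
  \<comment> \<open>The 2 stems from the two chains, one for each point; summing all coefficients
    gives one constant that dominates each.\<close>
  define C where "C = 2 * ((\<Sum>j=1..J1. c1 j) + (\<Sum>j=1..J2. c2 j))"
  have C1: "2 * c1 j \<le> C" if "j \<in> {1..J1}" for j
    using member_le_sum[of j "{1..J1}" c1] that c1 sum_nonneg[of "{1..J2}" c2] c2 by (auto simp: C_def)
  have C2: "2 * c2 j \<le> C" if "j \<in> {1..J2}" for j
    using member_le_sum[of j "{1..J2}" c2] that c2 sum_nonneg[of "{1..J1}" c1] c1 by (auto simp: C_def)
  have C0: "0 \<le> C" unfolding C_def using c1 c2 by (intro mult_nonneg_nonneg add_nonneg_nonneg sum_nonneg) auto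
  show ?thesis
  proof (intro exI[of _ C] allI impI ballI)
    fix I1 I2 :: "real set" and E :: "'e metric" and G :: "real \<times> real \<Rightarrow> 'e"
      and A1 A2 :: "nat \<Rightarrow> real \<times> real \<times> real \<Rightarrow> real" and M1 M2 :: "nat \<Rightarrow> real"
      and x1 x2 y1 y2 :: real
    assume I: "nontrivial_interval I1" "nontrivial_interval I2"
      and L: "emeasure lborel I1 = L1" "emeasure lborel I2 = L2"
      and cont: "continuous_map (top_of_set (I1 \<times> I2)) (mtopology_of E) G"
      and meas: "\<forall>j\<in>{1..J1}. A1 j \<in> borel_measurable (lebesgue_on (I1 \<times> I1 \<times> I2))"
        "\<forall>j\<in>{1..J2}. A2 j \<in> borel_measurable (lebesgue_on (I1 \<times> I2 \<times> I2))"
      and G_le: "\<forall>x1\<in>I1. \<forall>x2\<in>I2. \<forall>y1\<in>I1. \<forall>y2\<in>I2.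
       mdist E (G (x1, x2)) (G (y1, y2))
         \<le> (\<Sum>j=1..J1. \<bar>A1 j (x1, y1, x2)\<bar>) + (\<Sum>j=1..J2. \<bar>A2 j (y1, x2, y2)\<bar>)"
      and M: "\<forall>j\<in>{1..J1}. 0 \<le> M1 j" "\<forall>j\<in>{1..J2}. 0 \<le> M2 j"
      and int1: "\<forall>j\<in>{1..J1}.
       (\<integral>\<^sup>+ (u1, v1, u2). ennreal (\<bar>A1 j (u1, v1, u2)\<bar> powr q1 j / \<bar>u1 - v1\<bar> powr \<beta>1 j)
          \<partial>lebesgue_on (I1 \<times> I1 \<times> I2)) \<le> ennreal (M1 j)"
      and int2: "\<forall>j\<in>{1..J2}.
       (\<integral>\<^sup>+ (v1, u2, v2). ennreal (\<bar>A2 j (v1, u2, v2)\<bar> powr q2 j / \<bar>u2 - v2\<bar> powr \<beta>2 j)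
          \<partial>lebesgue_on (I1 \<times> I2 \<times> I2)) \<le> ennreal (M2 j)"
      and x: "x1 \<in> I1" "x2 \<in> I2" "y1 \<in> I1" "y2 \<in> I2"
    have I': "is_interval I1" "I1 \<in> sets borel" "is_interval I2" "I2 \<in> sets borel"
      using I nontrivial_interval_borel by (auto simp: nontrivial_interval_def)
    define X where "X = \<bar>x1 - y1\<bar>"
    define Y where "Y = \<bar>x2 - y2\<bar>"
    define w1 where "w1 j = X powr ((\<beta>1 j - 2 - b) / q1 j) + Y powr (((\<beta>1 j - 2) * a - 1) / q1 j)" for j
    define w2 where "w2 j = X powr (((\<beta>2 j - 2) * b - 1) / q2 j) + Y powr ((\<beta>2 j - 2 - a) / q2 j)" for j
    define R where "R \<epsilon> = C * (\<Sum>j=1..J1. (M1 j + \<epsilon>) powr (1 / q1 j) * w1 j) + C * (\<Sum>j=1..J2. (M2 j + \<epsilon>) powr (1 / q2 j) * w2 j)" for \<epsilon>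
    have XY: "0 \<le> X" "0 \<le> Y" by (auto simp: X_def Y_def)
    have XL: "ennreal X \<le> L1" "ennreal Y \<le> L2"
      using interval_dist_le_measure I' x unfolding X_def Y_def L[symmetric] by blast+
    \<comment> \<open>The kernels are scaled by powers of the \<open>M\<close>, so these have to be positive.\<close>
    have pos: "mdist E (G (x1, x2)) (G (y1, y2)) \<le> R \<epsilon>" if \<epsilon>: "0 < \<epsilon>" for \<epsilon>
    \<comment> \<open>When both differences vanish the scales \<open>?s\<close> and
      \<open>?t\<close> would be 0, but then the two points coincide.\<close>
    proof (cases "X = 0 \<and> Y = 0")
      case True
      then have "mdist E (G (x1, x2)) (G (y1, y2)) = 0"
        using cont x by (auto simp: X_def Y_def continuous_map_def Pi_iff)
      also have "0 \<le> R \<epsilon>" unfolding R_def w1_def w2_def using C0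
        by (intro add_nonneg_nonneg mult_nonneg_nonneg sum_nonneg) auto
      finally show ?thesis .
    next
      case False
      interpret two_scale_estimate I1 I2 E G "{1..J1}" "{1..J2}" A1 A2 q1 q2 \<beta>1 \<beta>2
        "\<lambda>j. M1 j + \<epsilon>" "\<lambda>j. M2 j + \<epsilon>" \<theta>
      proof (unfold_locales, goal_cases)
        case (11 j)
        then show ?case using int1 M \<epsilon> by (meson add_increasing2 order_trans ennreal_leI less_imp_le order_refl)
      next
        case (12 j)
        then show ?case using int2 M \<epsilon> by (meson add_increasing2 order_trans ennreal_leI less_imp_le order_refl)
      qed (use I' cont meas G_le M \<epsilon> q \<theta>0 \<beta>1 \<beta>2 in \<open>auto intro: add_nonneg_pos\<close>)
      \<comment> \<open>The scales dominate \<open>X\<close> and \<open>Y\<close>, as a common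
        rectangle requires, and both are positive even if one of \<open>X\<close>, \<open>Y\<close>
        is 0.\<close>
      let ?s = "max X (Y powr a)" and ?t = "max Y (X powr b)"
      have st: "0 < ?s" "0 < ?t" using False XY by (auto simp: less_max_iff_disj)
      have "mdist E (G (x1, x2)) (G (y1, y2)) \<le> 2 * scale_bound \<kappa> ?s ?t"
        using x st \<kappa>(1,2) \<kappa>(3)[OF XY XL] L by (intro mdist_le_scale_bound) (auto simp: X_def Y_def)
      also have "\<dots> = (\<Sum>j=1..J1. 2 * c1 j * ((M1 j + \<epsilon>) powr (1 / q1 j) * (?s powr (\<beta>1 j - 2) / ?t) powr (1 / q1 j)))
        + (\<Sum>j=1..J2. 2 * c2 j * ((M2 j + \<epsilon>) powr (1 / q2 j) * (?t powr (\<beta>2 j - 2) / ?s) powr (1 / q2 j)))"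
        unfolding scale_bound_def c1_def c2_def by (simp add: distrib_left sum_distrib_left mult.assoc)
      also have "\<dots> \<le> (\<Sum>j=1..J1. C * ((M1 j + \<epsilon>) powr (1 / q1 j) * w1 j)) + (\<Sum>j=1..J2. C * ((M2 j + \<epsilon>) powr (1 / q2 j) * w2 j))"
      proof (intro add_mono sum_mono mult_mono C1 C2 order_refl)
        fix j assume "j \<in> {1..J1}"
        then show "(?s powr (\<beta>1 j - 2) / ?t) powr (1 / q1 j) \<le> w1 j"
          unfolding w1_def using False XY q by (intro max_scale_powr_le) auto
      next
        fix j assume "j \<in> {1..J2}"
        then show "(?t powr (\<beta>2 j - 2) / ?s) powr (1 / q2 j) \<le> w2 j"
          \<comment> \<open>The same comparison with the two directions, and with them
            \<open>a\<close> and \<open>b\<close>, interchanged.\<close>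
          using max_scale_powr_le[of Y X "q2 j" b "\<beta>2 j" a] False XY q by (auto simp: w2_def add.commute)
      qed (use C0 st in auto)
      also have "\<dots> = R \<epsilon>" unfolding R_def by (simp add: sum_distrib_left)
      finally show ?thesis .
    qed
    have "(R \<longlongrightarrow> R 0) (at_right 0)"
    proof -
      \<comment> \<open>At \<open>m = 0\<close> the base tends to 0; continuity still holds because
        the exponent is positive and the approach is from the right.\<close>
      have lim: "((\<lambda>\<epsilon>. (m + \<epsilon>) powr (1 / q')) \<longlongrightarrow> (m + 0) powr (1 / q')) (at_right 0)" if "0 \<le> m" "1 \<le> q'" for m q' :: real
      proof (rule tendsto_powr')
        show "m + 0 \<noteq> 0 \<or> 0 < 1 / q' \<and> (\<forall>\<^sub>F \<epsilon> in at_right 0. 0 \<le> m + \<epsilon>)"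
          using that by (auto simp: eventually_at_right_less intro!: eventually_at_rightI[of 0 1])
      qed (intro tendsto_intros)+
      show ?thesis
        unfolding R_def
        by (intro tendsto_add tendsto_mult tendsto_const tendsto_sum lim) (use M q in auto)
    qed
    moreover have "\<forall>\<^sub>F \<epsilon> in at_right 0. mdist E (G (x1, x2)) (G (y1, y2)) \<le> R \<epsilon>"
      by (intro eventually_at_rightI[of 0 1] pos) auto
    ultimately have "mdist E (G (x1, x2)) (G (y1, y2)) \<le> R 0"
      by (rule tendsto_lowerbound) simp
    then show "mdist E (G (x1, x2)) (G (y1, y2))
         \<le> C * (\<Sum>j=1..J1. M1 j powr (1 / q1 j) *
                 (\<bar>x1 - y1\<bar> powr ((\<beta>1 j - 2 - b) / q1 j)
                  + \<bar>x2 - y2\<bar> powr (((\<beta>1 j - 2) * a - 1) / q1 j)))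
           + C * (\<Sum>j=1..J2. M2 j powr (1 / q2 j) *
                 (\<bar>x1 - y1\<bar> powr (((\<beta>2 j - 2) * b - 1) / q2 j)
                  + \<bar>x2 - y2\<bar> powr ((\<beta>2 j - 2 - a) / q2 j)))"
      by (simp add: R_def w1_def w2_def X_def Y_def)
  qed
qed

end
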